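(* Let $p>5$ be a prime with $p\equiv 1\pmod 4$ and let $G=PSL(2,p)$. Let $a\in G$ have order $p$, and let $b\in G$ have order $\frac{p-1}{2}$ and satisfy $N_G(\langle a\rangle)=\langle a\rangle:\langle b\rangle\cong \mathbb{Z}_p:\mathbb{Z}_{\frac{p-1}{2}}$. Let $g\in G$ be an involution such that $N_G(\langle b^2\rangle)=\langle b\rangle:\langle g\rangle\cong D_{p-1}$. Let $H=\langle a\rangle:\langle b^2\rangle$. Then the coset graph $\mathrm{Cos}(G,H,HgH)$ is $2$-geodesic transitive but not $2$-arc transitive.
   Context: $X:Y$ denotes a semidirect (split) product with normal subgroup $X$; $D_{p-1}$ is the dihedral group of order $p-1$. Elements $a,b,g$ as in the claim always exist. For a finite group $G$, a core-free proper subgroup $H$ and an element $g\in G$ with $G=\langle H,g\rangle$ and $g^2\in H$, the coset graph $\mathrm{Cos}(G,H,HgH)$ has vertex set $\{Hx : x\in G\}$, with two vertices $Hx,Hy$ adjacent if and only if $yx^{-1}\in HgH$. It is a connected undirected graph of valency $|H:H\cap H^g|$. In the situation of the claim, $G=\langle H,g\rangle$ holds. A $2$-arc of a graph $\Gamma$ is a triple of vertices $(v_0,v_1,v_2)$ with $v_0\sim v_1\sim v_2$ and $v_0\ne v_2$; a $2$-geodesic is a $2$-arc with $v_0,v_2$ at distance $2$. $\Gamma$ is $2$-arc transitive if $\mathrm{Aut}(\Gamma)$ is transitive on arcs and on $2$-arcs. A connected graph $\Gamma$ of diameter at least $2$ is $2$-geodesic transitive if $\mathrm{Aut}(\Gamma)$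 is transitive on arcs and on $2$-geodesics. *)

theory Defs
  imports
    "HOL-Analysis.Determinants"
    "HOL-Algebra.Algebra"
    "Graph_Theory.Graph_Theory"
begin

section \<open>Groups\<close>

definition group_center :: "('a, 'b) monoid_scheme \<Rightarrow> 'a set" where
  "group_center G = {z \<in> carrier G. \<forall>x \<in> carrier G. z \<otimes>\<^bsub>G\<^esub> x = x \<otimes>\<^bsub>G\<^esub> z}"

definition SL :: "('k::field ^ 'n ^ 'n) monoid" where
  "SL = \<lparr>carrier = {A. det A = 1}, monoid.mult = (**), one = mat 1\<rparr>"

text \<open>The size and the field are given by the type: if \<open>'k\<close> is a field with \<open>q\<close> elements, then
  \<open>PSL :: ('k ^ 2 ^ 2) set monoid\<close> is the group $PSL(2,q)$.\<close>

definition PSL :: "('k::field ^ 'n ^ 'n) set monoid" where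
  "PSL = SL Mod (group_center SL)"

lemma group_SL: "group (SL :: ('k::field ^ 'n ^ 'n) monoid)"
proof (rule groupI)
  fix A :: "'k ^ 'n ^ 'n" assume "A \<in> carrier SL"
  then have A: "det A = 1" by (simp add: SL_def)
  then have "invertible A" by (simp add: invertible_det_nz)
  then obtain B where B: "A ** B = mat 1" "B ** A = mat 1"
    by (auto simp: invertible_def)
  have "det B = 1"
    using arg_cong[OF B(1), of det] A by (simp add: det_mul)
  then show "\<exists>B \<in> carrier SL. B \<otimes>\<^bsub>SL\<^esub> A = \<one>\<^bsub>SL\<^esub>"
    using B by (auto simp: SL_def)
qed (auto simp: SL_def det_mul matrix_mul_assoc)

lemma (in group) group_center_normal: "group_center G \<lhd> G"
proof -
  have sub: "subgroup (group_center G) G"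
  proof (rule subgroupI)
    show "group_center G \<subseteq> carrier G" by (auto simp: group_center_def)
    have "\<one> \<in> group_center G" by (simp add: group_center_def)
    then show "group_center G \<noteq> {}" by blast
  next
    fix a assume a: "a \<in> group_center G"
    then have aG: "a \<in> carrier G" by (simp add: group_center_def)
    have "inv a \<otimes> x = x \<otimes> inv a" if x: "x \<in> carrier G" for x
    proof -
      have "a \<otimes> inv x = inv x \<otimes> a"
        using a x by (simp add: group_center_def)
      then have "inv (a \<otimes> inv x) = inv (inv x \<otimes> a)" by simp
      then show ?thesis using aG x by (simp add: inv_mult_group)
    qed
    then show "inv a \<in> group_center G" using aG by (simp add: group_center_def)
  next
    fix a b assume ab: "a \<in> group_center G" "b \<in> group_center G"
    then have G: "a \<in> carrier G" "b \<in> carrier G" by (auto simp: group_center_def)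
    have "a \<otimes> b \<otimes> x = x \<otimes> (a \<otimes> b)" if x: "x \<in> carrier G" for x
    proof -
      have "a \<otimes> b \<otimes> x = a \<otimes> (b \<otimes> x)" using G x by (simp add: m_assoc)
      also have "b \<otimes> x = x \<otimes> b" using ab x by (simp add: group_center_def)
      also have "a \<otimes> (x \<otimes> b) = a \<otimes> x \<otimes> b" using G x by (simp add: m_assoc)
      also have "a \<otimes> x = x \<otimes> a" using ab x by (simp add: group_center_def)
      finally show ?thesis using G x by (simp add: m_assoc)
    qed
    then show "a \<otimes> b \<in> group_center G" using G by (simp add: group_center_def)
  qed
  have "x \<otimes> h \<otimes> inv x = h" if "x \<in> carrier G" "h \<in> group_center G" for x h
  proof -
    have h: "h \<in> carrier G" and "x \<otimes> h = h \<otimes> x"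
      using that by (auto simp: group_center_def)
    then show ?thesis using that(1) by (simp add: m_assoc)
  qed
  with sub show ?thesis by (auto simp: normal_inv_iff)
qed

lemma group_PSL: "group (PSL :: ('k::field ^ 'n ^ 'n) set monoid)"
  unfolding PSL_def
  by (rule normal.factorgroup_is_group[OF group.group_center_normal[OF group_SL]])

text \<open>\<open>semidirect_decomp G K M N\<close>: the subset \<open>K\<close> of \<open>G\<close> is a subgroup and it is the internal
  semidirect product $M:N$ of its normal subgroup \<open>M\<close> and the complement \<open>N\<close>.\<close>

definition semidirect_decomp ::
  "('a, 'b) monoid_scheme \<Rightarrow> 'a set \<Rightarrow> 'a set \<Rightarrow> 'a set \<Rightarrow> bool" where
  "semidirect_decomp G K M N \<longleftrightarrow>
     subgroup K G \<and> M \<lhd> G\<lparr>carrier := K\<rparr> \<and> subgroup N G \<and>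
     M <#>\<^bsub>G\<^esub> N = K \<and> M \<inter> N = {\<one>\<^bsub>G\<^esub>}"

text \<open>\<open>G\<close> is isomorphic to some split extension $P:Q$; this notation for a group up to isomorphism
  does not specify the action of \<open>Q\<close> on \<open>P\<close>.\<close>

definition split_extension ::
  "('a, 'b) monoid_scheme \<Rightarrow> ('c, 'd) monoid_scheme \<Rightarrow> ('e, 'f) monoid_scheme \<Rightarrow> bool" where
  "split_extension G P Q \<longleftrightarrow>
     (\<exists>M N. semidirect_decomp G (carrier G) M N \<and>
        G\<lparr>carrier := M\<rparr> \<cong> P \<and> G\<lparr>carrier := N\<rparr> \<cong> Q)"

text \<open>The dihedral group of order \<open>2 * n\<close>: the pair \<open>(i, s)\<close> stands for $r^i$ if \<open>\<not> s\<close> and for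
  $r^i t$ if \<open>s\<close>, where $r^n = t^2 = 1$ and $t r t = r^{-1}$.\<close>

definition dihedral_group :: "nat \<Rightarrow> (int \<times> bool) monoid" where
  "dihedral_group n =
     \<lparr>carrier = {0..<int n} \<times> UNIV,
      monoid.mult = (\<lambda>(i, s) (j, t). ((if s then i - j else i + j) mod int n, s \<noteq> t)),
      one = (0, False)\<rparr>"

lemma order_dihedral_group: "order (dihedral_group n) = 2 * n"
  by (simp add: order_def dihedral_group_def card_cartesian_product)

lemma group_dihedral_group:
  assumes "n > 0"
  shows "group (dihedral_group n)"
proof (rule groupI)
  fix x assume x: "x \<in> carrier (dihedral_group n)"
  obtain i s where xis: "x = (i, s)" by (cases x)
  show "\<exists>y \<in> carrier (dihedral_group n). y \<otimes>\<^bsub>dihedral_group n\<^esub> x = \<one>\<^bsub>dihedral_group n\<^esub>"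
    using assms x xis
    by (intro bexI[of _ "(if s then i else (- i) mod int n, s)"])
      (auto simp: dihedral_group_def mod_add_left_eq)
qed (use assms in \<open>auto simp: dihedral_group_def mod_simps algebra_simps\<close>)


section \<open>Graphs\<close>

text \<open>An undirected graph is represented by the symmetric set of its arcs;
  \<open>pair_bidirected_digraph\<close> says that it is well-formed, symmetric and loop-free.\<close>

definition graph_aut :: "'a pair_pre_digraph \<Rightarrow> ('a \<Rightarrow> 'a) set" where
  "graph_aut \<Gamma> = {f. bij_betw f (pverts \<Gamma>) (pverts \<Gamma>) \<and>
     (\<forall>u \<in> pverts \<Gamma>. \<forall>v \<in> pverts \<Gamma>. (f u, f v) \<in> parcs \<Gamma> \<longleftrightarrow> (u, v) \<in> parcs \<Gamma>)}"

definition graph_dist :: "'a pair_pre_digraph \<Rightarrow> 'a \<Rightarrow> 'a \<Rightarrow> ereal" where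
  "graph_dist \<Gamma> u v = wf_digraph.\<mu> (with_proj \<Gamma>) (\<lambda>_. 1) u v"

definition graph_diameter :: "'a pair_pre_digraph \<Rightarrow> ereal" where
  "graph_diameter \<Gamma> = (SUP u \<in> pverts \<Gamma>. SUP v \<in> pverts \<Gamma>. graph_dist \<Gamma> u v)"

definition two_arcs :: "'a pair_pre_digraph \<Rightarrow> ('a \<times> 'a \<times> 'a) set" where
  "two_arcs \<Gamma> = {(u, v, w). (u, v) \<in> parcs \<Gamma> \<and> (v, w) \<in> parcs \<Gamma> \<and> u \<noteq> w}"

definition two_geodesics :: "'a pair_pre_digraph \<Rightarrow> ('a \<times> 'a \<times> 'a) set" where
  "two_geodesics \<Gamma> = {(u, v, w). (u, v, w) \<in> two_arcs \<Gamma> \<and> graph_dist \<Gamma> u w = 2}"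

definition arc_transitive :: "'a pair_pre_digraph \<Rightarrow> bool" where
  "arc_transitive \<Gamma> \<longleftrightarrow>
     (\<forall>(u, v) \<in> parcs \<Gamma>. \<forall>(u', v') \<in> parcs \<Gamma>.
        \<exists>f \<in> graph_aut \<Gamma>. f u = u' \<and> f v = v')"

definition transitive_on_triples :: "'a pair_pre_digraph \<Rightarrow> ('a \<times> 'a \<times> 'a) set \<Rightarrow> bool" where
  "transitive_on_triples \<Gamma> T \<longleftrightarrow>
     (\<forall>(u, v, w) \<in> T. \<forall>(u', v', w') \<in> T.
        \<exists>f \<in> graph_aut \<Gamma>. f u = u' \<and> f v = v' \<and> f w = w')"

definition two_arc_transitive :: "'a pair_pre_digraph \<Rightarrow> bool" where
  "two_arc_transitive \<Gamma> \<longleftrightarrow> arc_transitive \<Gamma> \<and> transitive_on_triples \<Gamma> (two_arcs \<Gamma>)"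

definition two_geodesic_transitive :: "'a pair_pre_digraph \<Rightarrow> bool" where
  "two_geodesic_transitive \<Gamma> \<longleftrightarrow>
     pair_bidirected_digraph \<Gamma> \<and> Digraph_Component.connected (with_proj \<Gamma>) \<and>
     graph_diameter \<Gamma> \<ge> 2 \<and>
     arc_transitive \<Gamma> \<and> transitive_on_triples \<Gamma> (two_geodesics \<Gamma>)"

text \<open>\<open>coset_graph G H D\<close> is the graph $\mathrm{Cos}(G,H,D)$ for a union \<open>D\<close> of double cosets
  of \<open>H\<close>.\<close>

definition coset_graph ::
  "('a, 'b) monoid_scheme \<Rightarrow> 'a set \<Rightarrow> 'a set \<Rightarrow> 'a set pair_pre_digraph" where
  "coset_graph G H D =
     \<lparr>pverts = rcosets\<^bsub>G\<^esub> H,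
      parcs = {(H #>\<^bsub>G\<^esub> x, H #>\<^bsub>G\<^esub> y) | x y.
        x \<in> carrier G \<and> y \<in> carrier G \<and> y \<otimes>\<^bsub>G\<^esub> inv\<^bsub>G\<^esub> x \<in> D}\<rparr>"

definition double_coset :: "('a, 'b) monoid_scheme \<Rightarrow> 'a set \<Rightarrow> 'a \<Rightarrow> 'a set" where
  "double_coset G H g = (H #>\<^bsub>G\<^esub> g) <#>\<^bsub>G\<^esub> H"

end

theory Submission
  imports Defs "HOL-Number_Theory.Residues" "HOL-Computational_Algebra.Polynomial"
begin

text \<open>Let \<open>v0\<close> be a row vector fixed by a lift of \<open>a\<close> to $SL(2,p)$. Then the normalizer of \<open>\<langle>a\<rangle>\<close> is the
  stabilizer of the line of \<open>v0\<close>, the eigenvalue of \<open>b\<close> on \<open>v0\<close> is a nonsquare, and \<open>H\<close> is the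
  stabilizer of \<open>v0\<close> modulo nonzero squares. So \<open>H x\<close> corresponds to the class of \<open>v0 x\<close> modulo
  squares, and two classes are adjacent iff they have representatives \<open>u, v\<close> with
  \<open>det (u, v) = \<kappa>\<close>, where \<open>\<kappa> = det (v0, v0 g)\<close>. Since \<open>-1\<close> is a square, this is symmetric. Matrices
  with square determinant act by automorphisms. Fix a nonsquare \<open>e\<close>. After rescaling \<open>u\<close> and \<open>v\<close> by
  squares, every 2-geodesic has the form \<open>(u, v, u + e v)\<close>, so the automorphisms permute the
  2-geodesics transitively, while \<open>(u, v, u + v)\<close> is a triangle.\<close>

section \<open>Squares in finite fields\<close>

text \<open>Automorphisms outside PSL(2,p) are what makes the graph 2-geodesic transitive. There are
  2(p+1) vertices of valency p, so an arc stabilizer in PSL(2,p) has order (p-1)/4, while an arc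
  extends to (p-1)/2 2-geodesics. A matrix of determinant s^2 is s times a matrix of determinant 1,
  and scaling by a nonsquare s moves every vertex, which supplies the missing factor 2. Elements of
  PSL(2,p) have two lifts with opposite eigenvalues; as -1 is a square, whether an eigenvalue is a
  square does not depend on the lift. The eigenvalue of \<open>b\<close> is a nonsquare because all
  eigenvalues occurring in the normalizer of the group of \<open>a\<close> are, up to sign, its
  powers, and these include nonsquares. The remaining obstacle is that \<open>g\<close> must move
  the line of \<open>v0\<close>, that is, \<open>\<kappa>\<close> is nonzero; there the normalizer
  of the group of \<open>b^2\<close> enters, together with \<open>b^2\<close> being nontrivial,
  which p > 5 guarantees.\<close>

definition nz_square :: "'k::field \<Rightarrow> bool" where
  "nz_square x \<longleftrightarrow> (\<exists>s. s \<noteq> 0 \<and> x = s ^ 2)"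

lemma nz_square_nonzero: "nz_square x \<Longrightarrow> x \<noteq> 0"
  by (auto simp: nz_square_def)

lemma nz_square_power2: "s \<noteq> 0 \<Longrightarrow> nz_square (s ^ 2)"
  by (auto simp: nz_square_def)

lemma nz_square_mult: "nz_square x \<Longrightarrow> nz_square y \<Longrightarrow> nz_square (x * y)"
  unfolding nz_square_def by (metis mult_eq_0_iff power_mult_distrib)

lemma nz_square_inverse: "nz_square x \<Longrightarrow> nz_square (inverse x)"
proof -
  assume "nz_square x"
  then obtain s where "s \<noteq> 0" "x = s ^ 2" by (auto simp: nz_square_def)
  then show "nz_square (inverse x)"
    using nz_square_power2[of "inverse s"] by (simp add: power_inverse)
qed

lemma nz_square_mult_iff:
  assumes "nz_square x"
  shows "nz_square (x * y) \<longleftrightarrow> nz_square y"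
proof
  assume "nz_square (x * y)"
  then have "nz_square (inverse x * (x * y))"
    by (rule nz_square_mult[OF nz_square_inverse[OF assms]])
  moreover have "inverse x * (x * y) = y"
    using nz_square_nonzero[OF assms] by (simp add: mult.assoc[symmetric])
  ultimately show "nz_square y" by simp
qed (simp add: nz_square_mult assms)

lemma nz_square_power2_mult_iff: "s \<noteq> 0 \<Longrightarrow> nz_square (s ^ 2 * y) \<longleftrightarrow> nz_square y"
  by (simp add: nz_square_mult_iff nz_square_power2)

text \<open>Multiplication by \<open>x\<close> permutes the nonzero elements, so their product
  acquires the factor \<open>x ^ (CARD('k) - 1)\<close> without changing.\<close>

lemma power_card_minus_1_eq_1:
  fixes x :: "'k::field"
  assumes "finite (UNIV :: 'k set)" "x \<noteq> 0"
  shows "x ^ (CARD('k) - 1) = 1"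
proof -
  have "x ^ (CARD('k) - 1) * \<Prod>(UNIV-{0}) = (\<Prod>y\<in>UNIV-{0}. x * y)"
    using assms by (simp add: prod.distrib)
  also have "\<dots> = \<Prod>(UNIV-{0})"
    by (rule prod.reindex_bij_witness[of _ "\<lambda>y. y / x" "\<lambda>y. x * y"]) (use assms in auto)
  finally show ?thesis
    using assms by (simp add: prod_zero_iff)
qed

lemma CHAR_eq_prime_card:
  assumes "normalization_semidom_class.prime CARD('k::field)"
  shows "CHAR('k) = CARD('k)"
proof -
  have "CHAR('k) dvd CARD('k)" by (rule CHAR_dvd_CARD)
  then show ?thesis
    using assms CHAR_not_1 prime_nat_iff by (metis One_nat_def)
qed

lemma two_neq_zero_of_odd_prime_card:
  assumes "normalization_semidom_class.prime CARD('k::field)" "CARD('k) \<noteq> 2"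
  shows "(2 :: 'k) \<noteq> 0"
proof
  assume "(2 :: 'k) = 0"
  then have "of_nat 2 = (0 :: 'k)" by simp
  then have "CARD('k) dvd 2"
    unfolding of_nat_eq_0_iff_char_dvd CHAR_eq_prime_card[OF assms(1)] .
  then show False
    using assms by (meson primes_dvd_imp_eq two_is_prime_nat)
qed

text \<open>The characteristic equals the cardinality, so the first \<open>CARD('k)\<close> naturals
  have distinct images. This later shows that the powers of a single transvection exhaust all
  transvections along the same line.\<close>

lemma surj_of_nat_prime_card:
  assumes "normalization_semidom_class.prime CARD('k::field)"
  shows "surj (of_nat :: nat \<Rightarrow> 'k)"
proof -
  let ?f = "of_nat :: nat \<Rightarrow> 'k"
  have fin: "finite (UNIV :: 'k set)"
    using prime_gt_0_nat[OF assms] card_gt_0_iff by blast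
  have "inj_on ?f {..<CARD('k)}"
    unfolding inj_on_def of_nat_eq_iff_cong_CHAR CHAR_eq_prime_card[OF assms]
    by (simp add: cong_def)
  then have "card (?f ` {..<CARD('k)}) = CARD('k)"
    by (simp add: card_image)
  then have "?f ` {..<CARD('k)} = UNIV"
    by (intro card_subset_eq fin) auto
  then show ?thesis by blast
qed

context
  assumes card_mod_4: "CARD('k::field) mod 4 = 1"
    and two_neq_zero: "(2 :: 'k) \<noteq> 0"
begin

lemma finite_UNIV_field: "finite (UNIV :: 'k set)"
  using card_mod_4 by (cases "finite (UNIV :: 'k set)") auto

lemma card_nonzero: "card (UNIV - {0 :: 'k}) = CARD('k) - 1"
  using finite_UNIV_field by (simp add: card_Diff_singleton)

text \<open>Squaring is two-to-one on nonzero elements: \<open>s\<close> and \<open>- s\<close> are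
  distinct because 2 is nonzero.\<close>

lemma card_nz_squares: "2 * card {x :: 'k. nz_square x} = CARD('k) - 1"
proof -
  let ?S = "{x :: 'k. nz_square x}"
  have "card (UNIV - {0 :: 'k}) = (\<Sum>x\<in>?S. card {s. s \<noteq> 0 \<and> s ^ 2 = x})"
  proof (subst card_UN_disjoint[symmetric])
    show "card (UNIV - {0 :: 'k}) = card (\<Union>x\<in>?S. {s. s \<noteq> 0 \<and> s ^ 2 = x})"
      by (rule arg_cong[of _ _ card]) (auto simp: nz_square_def)
  qed (auto intro: finite_subset[OF _ finite_UNIV_field])
  also have "\<dots> = (\<Sum>x\<in>?S. 2)"
  proof (rule sum.cong)
    fix x assume "x \<in> ?S"
    then obtain s where s: "s \<noteq> 0" "x = s ^ 2" by (auto simp: nz_square_def)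
    then have "t \<noteq> 0 \<and> t ^ 2 = x \<longleftrightarrow> t = s \<or> t = - s" for t
      by (metis neg_0_equal_iff_equal power2_eq_iff)
    then have "{s. s \<noteq> 0 \<and> s ^ 2 = x} = {s, - s}" by blast
    moreover have "s \<noteq> - s"
    proof
      assume "s = - s"
      then have "s + s = 0" by (metis add.right_inverse)
      then have "2 * s = 0" by (simp only: mult_2)
      then show False using s(1) two_neq_zero by simp
    qed
    ultimately show "card {s. s \<noteq> 0 \<and> s ^ 2 = x} = 2" by simp
  qed simp
  finally show ?thesis by (simp add: card_nonzero)
qed

lemma ex_nonsquare: "\<exists>e :: 'k. e \<noteq> 0 \<and> \<not> nz_square e"
proof (rule ccontr)
  assume "\<not> ?thesis"
  then have "UNIV - {0 :: 'k} \<subseteq> {x. nz_square x}" by auto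
  then have "CARD('k) - 1 \<le> card {x :: 'k. nz_square x}"
    unfolding card_nonzero[symmetric]
    by (rule card_mono[OF finite_subset[OF subset_UNIV finite_UNIV_field]])
  then have "card {x :: 'k. nz_square x} = 0"
    using card_nz_squares by linarith
  moreover have "nz_square (1 :: 'k)" using nz_square_power2[of 1] by simp
  ultimately show False
    using finite_subset[OF subset_UNIV finite_UNIV_field] by auto
qed

text \<open>The set of nonzero squares and its multiple by \<open>x\<close> are disjoint and each
  contains half of the nonzero elements. So \<open>y\<close> is \<open>x\<close> times a
  square.\<close>

lemma nz_square_mult_nonsquares:
  fixes x y :: 'k
  assumes "x \<noteq> 0" "y \<noteq> 0" "\<not> nz_square x" "\<not> nz_square y"
  shows "nz_square (x * y)"
proof -
  let ?S = "{x :: 'k. nz_square x}"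
  have fin: "finite A" for A :: "'k set"
    by (rule finite_subset[OF subset_UNIV finite_UNIV_field])
  have disj: "?S \<inter> (*) x ` ?S = {}"
    using assms(3) by (auto simp: mult.commute[of x] nz_square_mult_iff)
  have "card ((*) x ` ?S) = card ?S"
    by (rule card_image) (use assms(1) in \<open>auto simp: inj_on_def\<close>)
  then have "card (?S \<union> (*) x ` ?S) = card (UNIV - {0 :: 'k})"
    using disj fin card_nz_squares by (simp add: card_Un_disjoint card_nonzero)
  then have "?S \<union> (*) x ` ?S = UNIV - {0}"
    by (intro card_subset_eq fin) (use assms(1) nz_square_nonzero in auto)
  then have "y \<in> (*) x ` ?S" using assms by auto
  then obtain z where "nz_square z" "y = x * z" by auto
  then have "x * y = x ^ 2 * z" by (simp add: power2_eq_square)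
  then show ?thesis
    using assms(1) \<open>nz_square z\<close> by (simp add: nz_square_power2_mult_iff)
qed

text \<open>By counting, the nonzero squares are all the roots of $x^{(q-1)/2} - 1$, and $-1$ is such a root.\<close>

lemma nz_square_minus_1: "nz_square (- 1 :: 'k)"
proof -
  define m where "m = (CARD('k) - 1) div 2"
  define f :: "'k poly" where "f = Polynomial.monom 1 m - 1"
  obtain q where q: "CARD('k) = 4 * q + 1"
    using card_mod_4 by (metis mult.commute div_mult_mod_eq)
  \<comment> \<open>The element 1 is a nonzero square, which makes \<open>m\<close> positive; for
    \<open>m = 0\<close> the polynomial \<open>f\<close> would vanish.\<close>
  have "{x :: 'k. nz_square x} \<noteq> {}" using nz_square_power2[of 1] by auto
  then have "card {x :: 'k. nz_square x} > 0"
    using finite_subset[OF subset_UNIV finite_UNIV_field] by (simp add: card_gt_0_iff)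
  then have "CARD('k) > 1" using card_nz_squares by linarith
  then have m: "m = 2 * q" "q > 0" unfolding m_def using q by auto
  have deg: "Polynomial.degree f = m" "f \<noteq> 0"
  proof -
    have "Polynomial.coeff f m = 1" using m by (simp add: f_def)
    then show "f \<noteq> 0" by auto
    have "Polynomial.degree f \<le> m" unfolding f_def by (intro degree_diff_le) (auto simp: Polynomial.degree_monom_le)
    with \<open>Polynomial.coeff f m = 1\<close> show "Polynomial.degree f = m" by (intro antisym le_degree) auto
  qed
  have roots: "{x. poly f x = 0} = {x. nz_square x}"
  proof (rule sym, rule card_subset_eq)
    show sub: "{x. nz_square x} \<subseteq> {x. poly f x = 0}"
    proof clarsimp
      fix x :: 'k assume "nz_square x"
      then obtain s where "s \<noteq> 0" "x = s ^ 2" by (auto simp: nz_square_def)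
      then have "x ^ m = s ^ (CARD('k) - 1)" using m q by (simp flip: power_mult)
      then show "poly f x = 0"
        using power_card_minus_1_eq_1[OF finite_UNIV_field \<open>s \<noteq> 0\<close>]
        by (simp add: f_def poly_monom)
    qed
    have "card {x. nz_square (x :: 'k)} = m" using card_nz_squares m q by simp
    moreover have "card {x :: 'k. nz_square x} \<le> card {x. poly f x = 0}"
      by (rule card_mono[OF finite_subset[OF subset_UNIV finite_UNIV_field] sub])
    moreover have "card {x. poly f x = 0} \<le> m"
      using card_poly_roots_bound[OF deg(2)] deg(1) by simp
    ultimately show "card {x :: 'k. nz_square x} = card {x. poly f x = 0}" by linarith
  qed (rule finite_subset[OF subset_UNIV finite_UNIV_field])
  have "poly f (- 1) = 0" using m by (simp add: f_def poly_monom)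
  then show ?thesis using roots by auto
qed

end

section \<open>Row vectors in dimension two\<close>

definition det2 :: "'k::comm_ring_1 ^ 2 \<Rightarrow> 'k ^ 2 \<Rightarrow> 'k" where
  "det2 u v = u $ 1 * v $ 2 - u $ 2 * v $ 1"

lemmas vec2_simps = vec_eq_iff forall_2 vector_matrix_mult_def matrix_matrix_mult_def sum_2
  det_2 det2_def

lemma det2_bilinear [simp]:
  "det2 (u + u') v = det2 u v + det2 u' v" "det2 u (v + v') = det2 u v + det2 u v'"
  "det2 (c *s u) v = c * det2 u v" "det2 u (c *s v) = c * det2 u v"
  "det2 (- u) v = - det2 u v" "det2 u (- v) = - det2 u v"
  "det2 0 v = 0" "det2 u 0 = 0" "det2 u u = 0"
  by (simp_all add: det2_def algebra_simps)

lemma det2_swap: "det2 v u = - det2 u v"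
  by (simp add: det2_def algebra_simps)

lemma det2_vector_matrix_mult [simp]: "det2 (u v* M) (v v* M) = det M * det2 u v"
  by (simp add: vec2_simps algebra_simps)

lemma vector_matrix_mult_scale [simp]:
  fixes M :: "'k::comm_ring_1 ^ 2 ^ 2"
  shows "(c *s u) v* M = c *s (u v* M)"
  by (simp add: vec2_simps algebra_simps)

lemma vector_matrix_mult_uminus:
  fixes M :: "'k::comm_ring_1 ^ 2 ^ 2"
  shows "u v* (- M) = - (u v* M)" "(- u) v* M = - (u v* M)"
  by (simp_all add: vec2_simps algebra_simps)

text \<open>Cramer's rule with the denominator cleared.\<close>

lemma det2_scale_eq: "det2 u v *s w = det2 w v *s u + det2 u w *s v"
  by (simp add: vec2_simps algebra_simps)

lemma vec2_expand:
  fixes u v w :: "'k::field ^ 2"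
  assumes "det2 u v \<noteq> 0"
  obtains c d where "w = c *s u + d *s v"
proof
  have "w = inverse (det2 u v) *s (det2 u v *s w)"
    using assms by (simp add: vector_smult_assoc)
  also have "\<dots> = (inverse (det2 u v) * det2 w v) *s u + (inverse (det2 u v) * det2 u w) *s v"
    by (subst det2_scale_eq) (simp add: vector_add_ldistrib vector_smult_assoc)
  finally show "w = (inverse (det2 u v) * det2 w v) *s u + (inverse (det2 u v) * det2 u w) *s v" .
qed

lemma ex_det2_eq:
  fixes u :: "'k::field ^ 2"
  assumes "u \<noteq> 0"
  obtains v where "det2 u v = c"
proof (cases "u $ 1 = 0")
  case True
  moreover have "u $ 2 \<noteq> 0"
    using assms True unfolding vec_eq_iff forall_2 by simp
  ultimately have "det2 u (vector [- (c / u $ 2), 0]) = c"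
    by (simp add: det2_def)
  then show ?thesis by (rule that)
next
  case False
  then have "det2 u (vector [0, c / u $ 1]) = c"
    by (simp add: det2_def)
  then show ?thesis by (rule that)
qed

lemma det2_eq_zero_imp:
  fixes u v :: "'k::field ^ 2"
  assumes "u \<noteq> 0" "det2 u v = 0"
  obtains c where "v = c *s u"
proof -
  obtain w where w: "det2 u w = 1" using ex_det2_eq[OF assms(1)] .
  then obtain c d where "v = c *s u + d *s w" using vec2_expand[of u w v] by auto
  moreover then have "d = 0" using assms(2) w by simp
  ultimately show ?thesis using that[of c] by simp
qed

lemma ex_matrix_det2:
  fixes u v u' v' :: "'k::field ^ 2"
  assumes "det2 u v \<noteq> 0"
  obtains M where "u v* M = u'" "v v* M = v'" "det M * det2 u v = det2 u' v'"
proof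
  define i where "i = inverse (det2 u v)"
  have i: "i * (u $ 1 * v $ 2 - u $ 2 * v $ 1) = 1"
    using assms by (simp add: i_def det2_def)
  \<comment> \<open>The inverse of the matrix with rows \<open>u\<close>, \<open>v\<close>, by the
    adjugate formula, times the matrix with rows \<open>u'\<close>, \<open>v'\<close>.\<close>
  define M :: "'k ^ 2 ^ 2" where
    "M = vector [(i * v $ 2) *s u' - (i * u $ 2) *s v', (i * u $ 1) *s v' - (i * v $ 1) *s u']"
  have "(u v* M) $ j = (i * (u $ 1 * v $ 2 - u $ 2 * v $ 1)) * u' $ j"
    and "(v v* M) $ j = (i * (u $ 1 * v $ 2 - u $ 2 * v $ 1)) * v' $ j" for j
    by (simp_all add: vector_matrix_mult_def sum_2 M_def algebra_simps)
  then show u: "u v* M = u'" and v: "v v* M = v'"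
    unfolding i by (simp_all add: vec_eq_iff)
  show "det M * det2 u v = det2 u' v'"
    by (metis u v det2_vector_matrix_mult)
qed

lemma matrix_eq_on_basis:
  fixes u v :: "'k::field ^ 2"
  assumes "det2 u v \<noteq> 0" "u v* M = u v* N" "v v* M = v v* N"
  shows "M = (N :: 'k ^ 2 ^ 2)"
proof -
  have "w v* M = w v* N" for w
  proof -
    obtain c d where "w = c *s u + d *s v" using vec2_expand[OF assms(1)] .
    then show ?thesis using assms by (simp add: vector_matrix_left_distrib)
  qed
  from this[of "vector [1, 0]"] this[of "vector [0, 1]"] show ?thesis
    by (simp add: vec2_simps)
qed

lemma vector_matrix_mult_eq_0_iff:
  fixes M :: "'k::field ^ 2 ^ 2"
  assumes "det M \<noteq> 0"
  shows "u v* M = 0 \<longleftrightarrow> u = 0"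
proof
  assume *: "u v* M = 0"
  show "u = 0"
  proof (rule ccontr)
    assume "u \<noteq> 0"
    then obtain v where "det2 u v = 1" by (rule ex_det2_eq)
    then show False using det2_vector_matrix_mult[of u M v] * assms by simp
  qed
qed simp

lemma vector_matrix_mult_inject:
  fixes M :: "'k::field ^ 2 ^ 2"
  assumes "det M \<noteq> 0" "u v* M = v v* M"
  shows "u = v"
proof -
  have "(u - v) v* M = 0"
    using assms(2) by (simp add: vector_matrix_mult_diff_distrib)
  then show ?thesis using vector_matrix_mult_eq_0_iff[OF assms(1)] by simp
qed

section \<open>The graph on vectors modulo squares\<close>

text \<open>This isolates the graph argument from the group: the facts on squares are assumptions,
  and the coset graph is an instance. The value of \<open>\<phi>\<close> at 0 is unconstrained;
  \<open>parcs_eq\<close> avoids it because a nonzero determinant forces nonzero vectors.\<close>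

locale square_class_graph =
  fixes \<Gamma> :: "'v pair_pre_digraph" and \<phi> :: "'k::field ^ 2 \<Rightarrow> 'v" and \<kappa> :: 'k
  assumes pverts_eq: "pverts \<Gamma> = \<phi> ` {v. v \<noteq> 0}"
    and phi_eq_iff: "u \<noteq> 0 \<Longrightarrow> v \<noteq> 0 \<Longrightarrow> \<phi> u = \<phi> v \<longleftrightarrow> (\<exists>c. nz_square c \<and> v = c *s u)"
    and parcs_eq: "parcs \<Gamma> = {(\<phi> u, \<phi> v) | u v. det2 u v = \<kappa>}"
    and kappa_nonzero: "\<kappa> \<noteq> 0"
    and minus_1_square: "nz_square (- 1 :: 'k)"
    and nonsquare: "\<exists>e :: 'k. e \<noteq> 0 \<and> \<not> nz_square e"
    and mult_nonsquares: "\<And>x y :: 'k. x \<noteq> 0 \<Longrightarrow> y \<noteq> 0 \<Longrightarrow> \<not> nz_square x \<Longrightarrow> \<not> nz_square y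
          \<Longrightarrow> nz_square (x * y)"
begin

lemma square_uminus_iff: "nz_square (- x) \<longleftrightarrow> nz_square (x :: 'k)"
  using nz_square_mult_iff[OF minus_1_square, of x] by simp

lemma phi_scale:
  assumes "nz_square c" "u \<noteq> 0"
  shows "\<phi> (c *s u) = \<phi> u"
proof -
  have "c *s u \<noteq> 0" using assms nz_square_nonzero by simp
  then show ?thesis using phi_eq_iff[of u "c *s u"] assms by auto
qed

lemma det2_nonzero_args: "det2 u v \<noteq> (0 :: 'k) \<Longrightarrow> u \<noteq> 0 \<and> v \<noteq> 0"
  by auto

text \<open>Rescaling representatives by squares multiplies \<open>det2\<close> by a square, so
  adjacency can be tested on arbitrary representatives.\<close>

lemma arc_iff:
  assumes "u \<noteq> 0" "v \<noteq> 0"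
  shows "(\<phi> u, \<phi> v) \<in> parcs \<Gamma> \<longleftrightarrow> nz_square (det2 u v / \<kappa>)"
proof
  assume "(\<phi> u, \<phi> v) \<in> parcs \<Gamma>"
  then obtain u' v' where eq: "\<phi> u = \<phi> u'" "\<phi> v = \<phi> v'" and det: "det2 u' v' = \<kappa>"
    by (auto simp: parcs_eq)
  have "u' \<noteq> 0" "v' \<noteq> 0" using det kappa_nonzero by auto
  then obtain c d where c: "nz_square c" "u' = c *s u" and d: "nz_square d" "v' = d *s v"
    using eq phi_eq_iff assms by meson
  then have "\<kappa> = c * d * det2 u v" using det by (simp add: mult_ac)
  then have "det2 u v / \<kappa> = inverse (c * d)"
    using kappa_nonzero by (auto simp: field_simps)
  then show "nz_square (det2 u v / \<kappa>)"
    using nz_square_inverse[OF nz_square_mult[OF c(1) d(1)]] by simp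
next
  assume sq: "nz_square (det2 u v / \<kappa>)"
  let ?c = "inverse (det2 u v / \<kappa>)"
  have "det2 u (?c *s v) = \<kappa>"
    using nz_square_nonzero[OF sq] kappa_nonzero by simp
  then have "(\<phi> u, \<phi> (?c *s v)) \<in> parcs \<Gamma>" unfolding parcs_eq by blast
  then show "(\<phi> u, \<phi> v) \<in> parcs \<Gamma>"
    using phi_scale[OF nz_square_inverse[OF sq] assms(2)] by simp
qed

lemma vertexE:
  assumes "x \<in> pverts \<Gamma>"
  obtains v where "v \<noteq> 0" "x = \<phi> v"
  using assms by (auto simp: pverts_eq)

lemma arc_vectorsE:
  assumes "(x, y) \<in> parcs \<Gamma>"
  obtains u v where "x = \<phi> u" "y = \<phi> v" "det2 u v = \<kappa>" "u \<noteq> 0" "v \<noteq> 0"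
proof -
  obtain u v where "x = \<phi> u" "y = \<phi> v" "det2 u v = \<kappa>" using assms by (auto simp: parcs_eq)
  then show ?thesis using that kappa_nonzero det2_nonzero_args[of u v] by auto
qed

lemma arc_sym: "(x, y) \<in> parcs \<Gamma> \<Longrightarrow> (y, x) \<in> parcs \<Gamma>"
proof (erule arc_vectorsE)
  fix u v assume *: "x = \<phi> u" "y = \<phi> v" "det2 u v = \<kappa>" "u \<noteq> 0" "v \<noteq> 0"
  then have "det2 v u / \<kappa> = - 1" using kappa_nonzero by (simp add: det2_swap[of v u])
  then show "(y, x) \<in> parcs \<Gamma>" using * arc_iff[of v u] minus_1_square by simp
qed

sublocale pair_bidirected_digraph \<Gamma>
proof unfold_locales
  fix e assume e: "e \<in> parcs \<Gamma>"
  obtain x y where xy: "e = (x, y)" by (cases e)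
  obtain u v where uv: "x = \<phi> u" "y = \<phi> v" "det2 u v = \<kappa>" "u \<noteq> 0" "v \<noteq> 0"
    using arc_vectorsE e xy by metis
  show "fst e \<in> pverts \<Gamma>" "snd e \<in> pverts \<Gamma>" using uv xy by (auto simp: pverts_eq)
  show "fst e \<noteq> snd e"
  proof
    assume "fst e = snd e"
    then obtain c where "v = c *s u" using phi_eq_iff uv xy by fastforce
    then show False using uv(3) kappa_nonzero by simp
  qed
next
  show "symmetric (with_proj \<Gamma>)"
    unfolding symmetric_def by (auto intro!: symI arc_sym)
qed

section \<open>Automorphisms induced by matrices of square determinant\<close>

definition act :: "'k ^ 2 ^ 2 \<Rightarrow> 'v \<Rightarrow> 'v" where
  "act M x = \<phi> ((SOME v. v \<noteq> 0 \<and> \<phi> v = x) v* M)"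

text \<open>Two representatives of a vertex differ by a square scalar, which commutes with the
  linear map, so the choice made in \<open>act\<close> does not matter.\<close>

lemma act_phi:
  assumes "det M \<noteq> 0" "v \<noteq> 0"
  shows "act M (\<phi> v) = \<phi> (v v* M)"
proof -
  define w where "w = (SOME w. w \<noteq> 0 \<and> \<phi> w = \<phi> v)"
  have w: "w \<noteq> 0" "\<phi> w = \<phi> v"
    using someI[of "\<lambda>w. w \<noteq> 0 \<and> \<phi> w = \<phi> v" v] assms(2) by (auto simp: w_def)
  then obtain c where c: "nz_square c" "v = c *s w" using phi_eq_iff assms(2) by blast
  then have "\<phi> (v v* M) = \<phi> (w v* M)"
    using w(1) assms(1) by (simp add: phi_scale vector_matrix_mult_eq_0_iff)
  then show ?thesis by (simp add: act_def w_def)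
qed

text \<open>The matrix multiplies \<open>det2\<close> by its determinant; a square factor leaves the
  criterion \<open>arc_iff\<close> unchanged.\<close>

lemma act_aut:
  assumes sq: "nz_square (det M)"
  shows "act M \<in> graph_aut \<Gamma>"
proof -
  have M: "det M \<noteq> 0" by (rule nz_square_nonzero[OF sq])
  then obtain N where N: "N ** M = mat 1" by (auto simp: invertible_det_nz[symmetric] invertible_def)
  have nz: "v v* M \<noteq> 0" if "v \<noteq> 0" for v
    using that M by (simp add: vector_matrix_mult_eq_0_iff)
  have "inj_on (act M) (pverts \<Gamma>)"
  proof (rule inj_onI, elim vertexE)
    fix x y u v assume *: "act M x = act M y" "u \<noteq> 0" "x = \<phi> u" "v \<noteq> 0" "y = \<phi> v"
    then have "\<phi> (u v* M) = \<phi> (v v* M)" by (simp add: act_phi M)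
    then obtain c where c: "nz_square c" "v v* M = c *s (u v* M)"
      using phi_eq_iff nz * by blast
    then have "v v* M = (c *s u) v* M" by simp
    then have "v = c *s u" by (rule vector_matrix_mult_inject[OF M])
    then show "x = y" using phi_scale c(1) * by simp
  qed
  moreover have "act M ` pverts \<Gamma> = pverts \<Gamma>"
  proof (intro equalityI subsetI)
    fix y assume "y \<in> act M ` pverts \<Gamma>"
    then show "y \<in> pverts \<Gamma>" using nz by (auto simp: pverts_eq act_phi M)
  next
    fix y assume "y \<in> pverts \<Gamma>"
    then obtain w where w: "w \<noteq> 0" "y = \<phi> w" by (rule vertexE)
    have "(w v* N) v* M = w" by (simp add: vector_matrix_mul_assoc N)
    moreover from this have "w v* N \<noteq> 0" using w by auto
    ultimately have "act M (\<phi> (w v* N)) = y" using w by (simp add: act_phi M)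
    then show "y \<in> act M ` pverts \<Gamma>" using \<open>w v* N \<noteq> 0\<close> by (auto simp: pverts_eq)
  qed
  moreover have "(act M x, act M y) \<in> parcs \<Gamma> \<longleftrightarrow> (x, y) \<in> parcs \<Gamma>"
    if xy: "x \<in> pverts \<Gamma>" "y \<in> pverts \<Gamma>" for x y
  proof -
    obtain u where u: "u \<noteq> 0" "x = \<phi> u" using vertexE[OF xy(1)] .
    obtain v where v: "v \<noteq> 0" "y = \<phi> v" using vertexE[OF xy(2)] .
    from u v show ?thesis
      using nz_square_mult_iff[OF sq, of "det2 u v / \<kappa>"] nz by (simp add: act_phi M arc_iff)
  qed
  ultimately show ?thesis by (simp add: graph_aut_def bij_betw_def)
qed

lemma arc_transitive: "arc_transitive \<Gamma>"
proof -
  have "\<exists>f\<in>graph_aut \<Gamma>. f x = x' \<and> f y = y'"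
    if arcs: "(x, y) \<in> parcs \<Gamma>" "(x', y') \<in> parcs \<Gamma>" for x y x' y'
  proof -
    obtain u v where uv: "x = \<phi> u" "y = \<phi> v" "det2 u v = \<kappa>" "u \<noteq> 0" "v \<noteq> 0"
      using arcs(1) by (rule arc_vectorsE)
    obtain u' v' where uv': "x' = \<phi> u'" "y' = \<phi> v'" "det2 u' v' = \<kappa>" "u' \<noteq> 0" "v' \<noteq> 0"
      using arcs(2) by (rule arc_vectorsE)
    obtain M where M: "u v* M = u'" "v v* M = v'" "det M * det2 u v = det2 u' v'"
      using ex_matrix_det2[of u v u' v'] uv(3) kappa_nonzero by auto
    then have det: "det M = 1" using uv(3) uv'(3) kappa_nonzero by simp
    then have "act M \<in> graph_aut \<Gamma>" using act_aut[of M] nz_square_power2[of 1] by simp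
    then show ?thesis
      using uv uv' M det by (intro bexI[of _ "act M"]) (simp_all add: act_phi)
  qed
  then show ?thesis unfolding arc_transitive_def by blast
qed

section \<open>Normal form of 2-geodesics and transitivity on them\<close>

lemma nonadjacent_two_arc_normal_form:
  assumes e: "e \<noteq> 0" "\<not> nz_square e"
    and arcs: "(x, y, z) \<in> two_arcs \<Gamma>" "(x, z) \<notin> parcs \<Gamma>"
  obtains u v where "u \<noteq> 0" "v \<noteq> 0" "x = \<phi> u" "y = \<phi> v" "z = \<phi> (u + e *s v)"
    "nz_square (det2 u v / \<kappa>)"
proof -
  have "(x, y) \<in> parcs \<Gamma>" using arcs(1) by (simp add: two_arcs_def)
  then obtain u v where uv: "x = \<phi> u" "y = \<phi> v" "det2 u v = \<kappa>" "u \<noteq> 0" "v \<noteq> 0"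
    by (rule arc_vectorsE)
  have "z \<in> pverts \<Gamma>" using arcs(1) by (auto simp: two_arcs_def elim!: arc_vectorsE simp: pverts_eq)
  then obtain w where w: "w \<noteq> 0" "z = \<phi> w" by (rule vertexE)
  obtain c d where cd: "w = c *s u + d *s v"
    using vec2_expand[of u v w] uv kappa_nonzero by auto
  have "(\<phi> v, \<phi> w) \<in> parcs \<Gamma>" using arcs(1) uv w by (simp add: two_arcs_def)
  then have "nz_square (det2 v w / \<kappa>)" using arc_iff uv w by blast
  \<comment> \<open>The coordinates of \<open>w\<close> encode adjacency: the arc from
    \<open>y\<close> to \<open>z\<close> makes \<open>c\<close> a square, and nonadjacency of
    \<open>x\<close> and \<open>z\<close> makes \<open>d\<close> a nonsquare.\<close>
  moreover have "det2 v w / \<kappa> = - c"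
    using uv kappa_nonzero by (simp add: cd det2_swap[of v u])
  ultimately have c: "nz_square c" by (simp add: square_uminus_iff)
  have "d \<noteq> 0"
  proof
    assume "d = 0"
    then have "w = c *s u" using cd by simp
    then have "z = x" using phi_scale[OF c uv(4)] w uv by simp
    then show False using arcs(1) by (simp add: two_arcs_def)
  qed
  have "\<not> nz_square (det2 u w / \<kappa>)" using arcs(2) uv w arc_iff by blast
  then have "\<not> nz_square d" using uv kappa_nonzero by (simp add: cd)
  then have "nz_square (d * e)" using mult_nonsquares \<open>d \<noteq> 0\<close> e by blast
  moreover have "d / e = inverse e ^ 2 * (d * e)"
    using e by (simp add: field_simps power2_eq_square)
  ultimately have de: "nz_square (d / e)"
    using e by (simp add: nz_square_power2_mult_iff)
  \<comment> \<open>Both vectors are rescaled by squares, so the vertices stay the same. The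
    determinant becomes \<open>c * (d / e) * \<kappa>\<close>; hence the normal form controls it
    only up to a square.\<close>
  show thesis
  proof
    show "c *s u \<noteq> 0" "(d / e) *s v \<noteq> 0"
      using uv nz_square_nonzero[OF c] \<open>d \<noteq> 0\<close> e by auto
    show "x = \<phi> (c *s u)" "y = \<phi> ((d / e) *s v)"
      using uv phi_scale c de by simp_all
    show "z = \<phi> (c *s u + e *s ((d / e) *s v))"
      using w cd e by (simp add: vector_smult_assoc)
    show "nz_square (det2 (c *s u) ((d / e) *s v) / \<kappa>)"
      using nz_square_mult[OF de c] uv kappa_nonzero by simp
  qed
qed

lemma graph_dist_le_1:
  assumes "(x, y) \<in> parcs \<Gamma>"
  shows "graph_dist \<Gamma> x y \<le> 1"
proof -
  have "awalk x [(x, y)] y"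
    using assms wellformed' by (auto simp: awalk_simps)
  from min_cost_le_walk_cost[OF this, of "\<lambda>_. 1"] show ?thesis
    by (simp add: graph_dist_def one_ereal_def)
qed

lemma graph_dist_ge_2:
  assumes "x \<noteq> y" "(x, y) \<notin> parcs \<Gamma>"
  shows "graph_dist \<Gamma> x y \<ge> 2"
  unfolding graph_dist_def \<mu>_def
proof (rule INF_greatest)
  fix p assume "p \<in> {p. awalk x p y}"
  then have p: "awalk x p y" by simp
  have "length p \<ge> 2"
  proof (cases p)
    case Nil
    then show ?thesis using p assms by (simp add: awalk_simps)
  next
    case (Cons e q)
    then show ?thesis using p assms by (cases q) (auto simp: awalk_simps)
  qed
  moreover have "awalk_cost (\<lambda>_. 1) p = real (length p)"
    by (induction p) auto
  ultimately show "2 \<le> ereal (awalk_cost (\<lambda>_. 1) p)" by simp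
qed

lemma transitive_on_two_geodesics: "transitive_on_triples \<Gamma> (two_geodesics \<Gamma>)"
proof -
  obtain e :: 'k where e: "e \<noteq> 0" "\<not> nz_square e" using nonsquare by blast
  \<comment> \<open>Distance 2 enters through nonadjacency of the ends, which is what the normal
    form requires.\<close>
  have nonadj: "(x, z) \<notin> parcs \<Gamma>" if "(x, y, z) \<in> two_geodesics \<Gamma>" for x y z
  proof
    assume "(x, z) \<in> parcs \<Gamma>"
    then have "graph_dist \<Gamma> x z \<le> 1" by (rule graph_dist_le_1)
    then show False using that by (simp add: two_geodesics_def)
  qed
  have "\<exists>f\<in>graph_aut \<Gamma>. f x = x' \<and> f y = y' \<and> f z = z'"
    if T: "(x, y, z) \<in> two_geodesics \<Gamma>" "(x', y', z') \<in> two_geodesics \<Gamma>" for x y z x' y' z'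
  proof -
    have A: "(x, y, z) \<in> two_arcs \<Gamma>" "(x', y', z') \<in> two_arcs \<Gamma>"
      using T by (auto simp: two_geodesics_def)
    obtain u v where uv: "u \<noteq> 0" "v \<noteq> 0" "x = \<phi> u" "y = \<phi> v" "z = \<phi> (u + e *s v)"
      and sq: "nz_square (det2 u v / \<kappa>)"
      by (rule nonadjacent_two_arc_normal_form[OF e A(1) nonadj[OF T(1)]])
    obtain u' v' where uv': "u' \<noteq> 0" "v' \<noteq> 0" "x' = \<phi> u'" "y' = \<phi> v'" "z' = \<phi> (u' + e *s v')"
      and sq': "nz_square (det2 u' v' / \<kappa>)"
      by (rule nonadjacent_two_arc_normal_form[OF e A(2) nonadj[OF T(2)]])
    have d: "det2 u v \<noteq> 0" using nz_square_nonzero[OF sq] by auto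
    then obtain M where M: "u v* M = u'" "v v* M = v'" "det M * det2 u v = det2 u' v'"
      by (rule ex_matrix_det2)
    \<comment> \<open>Both determinants are square multiples of \<open>\<kappa>\<close>, so
      \<open>det M\<close> is a square, though it need not be 1.\<close>
    have "det2 u' v' / \<kappa> = (det2 u v / \<kappa>) * det M" using M(3) by (simp add: mult.commute)
    then have sqM: "nz_square (det M)" using sq' nz_square_mult_iff[OF sq] by metis
    have "u + e *s v \<noteq> 0"
    proof
      assume "u + e *s v = 0"
      then have "det2 (u + e *s v) v = 0" by simp
      then show False using d by simp
    qed
    moreover have "(u + e *s v) v* M = u' + e *s v'"
      using M by (simp add: vector_matrix_left_distrib)
    ultimately show ?thesis
      using act_aut[OF sqM] M uv uv' nz_square_nonzero[OF sqM]
      by (intro bexI[of _ "act M"]) (simp_all add: act_phi)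
  qed
  then show ?thesis unfolding transitive_on_triples_def by blast
qed

section \<open>Triangles and open 2-arcs\<close>

lemma ex_arc:
  obtains u v where "det2 u v = \<kappa>" "u \<noteq> 0" "v \<noteq> 0"
proof -
  have "(vector [1, 0] :: 'k ^ 2) \<noteq> 0" unfolding vec_eq_iff forall_2 by simp
  then obtain v :: "'k ^ 2" where "det2 (vector [1, 0]) v = \<kappa>" by (rule ex_det2_eq)
  then show thesis using that kappa_nonzero det2_nonzero_args by metis
qed

lemma ex_nonadjacent_two_arc: "\<exists>x y z. (x, y, z) \<in> two_arcs \<Gamma> \<and> (x, z) \<notin> parcs \<Gamma>"
proof -
  obtain u v :: "'k ^ 2" where uv: "det2 u v = \<kappa>" "u \<noteq> 0" "v \<noteq> 0" by (rule ex_arc)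
  obtain e :: 'k where e: "e \<noteq> 0" "\<not> nz_square e" using nonsquare by blast
  let ?w = "u + e *s v"
  have dets: "det2 v ?w = - \<kappa>" "det2 u ?w = e * \<kappa>" using uv by (simp_all add: det2_swap[of v u])
  then have w: "?w \<noteq> 0" using kappa_nonzero det2_nonzero_args[of v ?w] by auto
  have "(\<phi> u, \<phi> v) \<in> parcs \<Gamma>" using uv by (auto simp: parcs_eq)
  moreover have "(\<phi> v, \<phi> ?w) \<in> parcs \<Gamma>"
    using kappa_nonzero minus_1_square unfolding arc_iff[OF uv(3) w] dets by simp
  moreover have "(\<phi> u, \<phi> ?w) \<notin> parcs \<Gamma>"
    using kappa_nonzero e unfolding arc_iff[OF uv(2) w] dets by simp
  moreover have "\<phi> u \<noteq> \<phi> ?w"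
  proof
    assume "\<phi> u = \<phi> ?w"
    then obtain c where "?w = c *s u" using phi_eq_iff uv w by blast
    then have "det2 u ?w = 0" by simp
    then show False using dets e kappa_nonzero by simp
  qed
  ultimately show ?thesis
    by (intro exI[of _ "\<phi> u"] exI[of _ "\<phi> v"] exI[of _ "\<phi> ?w"]) (simp add: two_arcs_def)
qed

lemma ex_triangle: "\<exists>x y z. (x, y, z) \<in> two_arcs \<Gamma> \<and> (x, z) \<in> parcs \<Gamma>"
proof -
  obtain u v :: "'k ^ 2" where uv: "det2 u v = \<kappa>" "u \<noteq> 0" "v \<noteq> 0" by (rule ex_arc)
  let ?w = "u + v"
  have dets: "det2 v ?w = - \<kappa>" "det2 u ?w = \<kappa>" using uv by (simp_all add: det2_swap[of v u])
  then have w: "?w \<noteq> 0" using kappa_nonzero det2_nonzero_args[of v ?w] by auto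
  have "(\<phi> u, \<phi> v) \<in> parcs \<Gamma>" "(\<phi> u, \<phi> ?w) \<in> parcs \<Gamma>"
    unfolding parcs_eq using uv(1) dets(2) by blast+
  moreover have "(\<phi> v, \<phi> ?w) \<in> parcs \<Gamma>"
    using kappa_nonzero minus_1_square unfolding arc_iff[OF uv(3) w] dets by simp
  moreover have "\<phi> u \<noteq> \<phi> ?w"
    using pair_no_loops[OF \<open>(\<phi> u, \<phi> ?w) \<in> parcs \<Gamma>\<close>] by simp
  ultimately show ?thesis
    by (intro exI[of _ "\<phi> u"] exI[of _ "\<phi> v"] exI[of _ "\<phi> ?w"]) (simp add: two_arcs_def)
qed

text \<open>Automorphisms preserve adjacency of the two ends, so none takes a triangle to an open
  2-arc.\<close>

lemma not_two_arc_transitive: "\<not> two_arc_transitive \<Gamma>"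
proof
  assume "two_arc_transitive \<Gamma>"
  then have tr: "transitive_on_triples \<Gamma> (two_arcs \<Gamma>)" by (simp add: two_arc_transitive_def)
  obtain x y z where xyz: "(x, y, z) \<in> two_arcs \<Gamma>" "(x, z) \<in> parcs \<Gamma>"
    using ex_triangle by blast
  obtain x' y' z' where xyz': "(x', y', z') \<in> two_arcs \<Gamma>" "(x', z') \<notin> parcs \<Gamma>"
    using ex_nonadjacent_two_arc by blast
  obtain f where f: "f \<in> graph_aut \<Gamma>" "f x = x'" "f z = z'"
    using tr xyz(1) xyz'(1) unfolding transitive_on_triples_def by blast
  have "x \<in> pverts \<Gamma>" "z \<in> pverts \<Gamma>" using xyz(2) wellformed' by blast+
  then have "(f x, f z) \<in> parcs \<Gamma>" using f(1) xyz(2) by (simp add: graph_aut_def)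
  then show False using f xyz'(2) by simp
qed

section \<open>Connectivity and diameter\<close>

lemma reachable_of_det2_nonzero:
  assumes "det2 u w \<noteq> 0"
  shows "\<phi> u \<rightarrow>\<^sup>*\<^bsub>\<Gamma>\<^esub> \<phi> w"
proof (cases "nz_square (det2 u w / \<kappa>)")
  case True
  then have "(\<phi> u, \<phi> w) \<in> parcs \<Gamma>" using arc_iff det2_nonzero_args[OF assms] by blast
  then show ?thesis by (intro reachable_adjI) simp
next
  case False
  let ?d = "det2 u w / \<kappa>"
  \<comment> \<open>The vector \<open>u + w\<close> has the same determinant
    \<open>?d * \<kappa>\<close> with \<open>u\<close> on the left and with \<open>w\<close> on the
    right. The extra factor \<open>?d\<close> turns both into \<open>\<kappa>\<close> times a
    square, so \<open>?v\<close> is a common neighbour.\<close>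
  let ?v = "?d *s (u + w)"
  have d: "?d \<noteq> 0" using assms kappa_nonzero by simp
  have nz: "u \<noteq> 0" "w \<noteq> 0" using det2_nonzero_args[OF assms] by auto
  have dets: "det2 u ?v / \<kappa> = ?d ^ 2" "det2 ?v w / \<kappa> = ?d ^ 2"
    by (simp_all add: power2_eq_square)
  have v: "?v \<noteq> 0"
  proof
    assume "?v = 0"
    then have "det2 u ?v = 0" by (simp only: det2_bilinear)
    then have "?d ^ 2 = 0" using dets(1) by simp
    then show False using d by simp
  qed
  have "(\<phi> u, \<phi> ?v) \<in> parcs \<Gamma>" "(\<phi> ?v, \<phi> w) \<in> parcs \<Gamma>"
    unfolding arc_iff[OF nz(1) v] arc_iff[OF v nz(2)] dets by (rule nz_square_power2[OF d])+
  then show ?thesis by (intro reachable_trans[OF reachable_adjI reachable_adjI]) simp_all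
qed

lemma connected: "Digraph_Component.connected (with_proj \<Gamma>)"
proof -
  have "\<phi> u \<rightarrow>\<^sup>*\<^bsub>\<Gamma>\<^esub> \<phi> w" if nz: "u \<noteq> 0" "w \<noteq> 0" for u w
  proof (cases "det2 u w = 0")
    case True
    \<comment> \<open>Parallel vectors are joined through a vector independent of both.\<close>
    obtain v where v: "det2 u v = 1" using ex_det2_eq[OF nz(1)] .
    obtain c where c: "w = c *s u" using det2_eq_zero_imp[OF nz(1) True] .
    then have "c \<noteq> 0" using nz by auto
    then have "det2 v w \<noteq> 0" using v c by (simp add: det2_swap[of v u])
    moreover have "det2 u v \<noteq> 0" using v by simp
    ultimately show ?thesis by (metis reachable_trans reachable_of_det2_nonzero)
  qed (rule reachable_of_det2_nonzero)
  moreover have "pverts \<Gamma> \<noteq> {}" using ex_arc by (auto simp: pverts_eq)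
  ultimately show ?thesis
    unfolding connected_def strongly_connected_def
    by (auto simp: pverts_eq intro!: reachable_mk_symmetricI)
qed

lemma diameter_ge_2: "graph_diameter \<Gamma> \<ge> 2"
proof -
  obtain x y z where xyz: "(x, y, z) \<in> two_arcs \<Gamma>" "(x, z) \<notin> parcs \<Gamma>"
    using ex_nonadjacent_two_arc by blast
  then have "2 \<le> graph_dist \<Gamma> x z" by (intro graph_dist_ge_2) (auto simp: two_arcs_def)
  moreover have "x \<in> pverts \<Gamma>" "z \<in> pverts \<Gamma>"
    using xyz(1) wellformed' by (auto simp: two_arcs_def)
  ultimately show ?thesis
    unfolding graph_diameter_def by (intro SUP_upper2[of x] SUP_upper2[of z])
qed

lemma two_geodesic_transitive_not_two_arc_transitive:
  "two_geodesic_transitive \<Gamma> \<and> \<not> two_arc_transitive \<Gamma>"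
  using pair_bidirected_digraph_axioms connected diameter_ge_2 arc_transitive
    transitive_on_two_geodesics not_two_arc_transitive
  by (simp add: two_geodesic_transitive_def)

end

section \<open>The projective special linear group of degree two\<close>

text \<open>The coset of \<open>M\<close> modulo the centre of SL(2,k); computations in PSL(2,k) are
  done on such lifts. In characteristic 2 it would be a singleton.\<close>

definition pm :: "'k::field ^ 2 ^ 2 \<Rightarrow> ('k ^ 2 ^ 2) set" where
  "pm M = {M, - M}"

lemma SL_simps [simp]:
  "M \<in> carrier SL \<longleftrightarrow> det M = 1" "M \<otimes>\<^bsub>SL\<^esub> N = M ** N" "\<one>\<^bsub>SL\<^esub> = mat 1"
  by (simp_all add: SL_def)

lemma det_uminus_2 [simp]: "det (- M :: 'k::comm_ring_1 ^ 2 ^ 2) = det M"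
  by (simp add: det_2)

lemma uminus_matrix_mult:
  fixes M N :: "'k::comm_ring_1 ^ 2 ^ 2"
  shows "(- M) ** N = - (M ** N)" "M ** (- N) = - (M ** N)"
  by (simp_all add: vec2_simps algebra_simps)

text \<open>Commuting with the upper and the lower elementary transvection forces a scalar matrix,
  and determinant 1 leaves the scalars 1 and -1.\<close>

lemma group_center_SL: "group_center (SL :: ('k::field ^ 2 ^ 2) monoid) = {mat 1, - mat 1}"
proof (intro equalityI subsetI)
  fix Z :: "'k ^ 2 ^ 2" assume "Z \<in> group_center SL"
  then have det: "det Z = 1" and comm: "\<And>M. det M = 1 \<Longrightarrow> Z ** M = M ** Z"
    by (auto simp: group_center_def)
  have "Z ** vector [vector [1, 1], vector [0, 1]] = vector [vector [1, 1], vector [0, 1]] ** Z"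
    by (rule comm) (simp add: det_2)
  then have 1: "Z $ 2 $ 1 = 0" "Z $ 1 $ 1 = Z $ 2 $ 2"
    by (simp_all add: vec2_simps)
  have "Z ** vector [vector [1, 0], vector [1, 1]] = vector [vector [1, 0], vector [1, 1]] ** Z"
    by (rule comm) (simp add: det_2)
  then have 2: "Z $ 1 $ 2 = 0" by (simp add: vec2_simps)
  have "Z $ 2 $ 2 = 1 \<or> Z $ 2 $ 2 = - 1"
    using det 1 2 by (simp add: det_2 square_eq_1_iff)
  then show "Z \<in> {mat 1, - mat 1}"
    using 1 2 by (auto simp: vec_eq_iff forall_2 mat_def)
next
  fix Z :: "'k ^ 2 ^ 2" assume "Z \<in> {mat 1, - mat 1}"
  then show "Z \<in> group_center SL"
    by (auto simp: group_center_def uminus_matrix_mult)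
qed

lemma center_coset: "group_center SL #>\<^bsub>SL\<^esub> M = pm M"
  by (auto simp: group_center_SL r_coset_def pm_def uminus_matrix_mult)

lemma pm_eq_iff: "pm M = pm N \<longleftrightarrow> M = N \<or> M = - N"
  by (auto simp: pm_def doubleton_eq_iff)

lemma carrier_PSL: "carrier (PSL :: ('k::field ^ 2 ^ 2) set monoid) = pm ` {M. det M = 1}"
  by (auto simp: PSL_def FactGroup_def RCOSETS_def center_coset)

lemma mult_PSL:
  fixes M N :: "'k::field ^ 2 ^ 2"
  assumes "det M = 1" "det N = 1"
  shows "pm M \<otimes>\<^bsub>PSL\<^esub> pm N = pm (M ** N)"
  using normal.rcos_sum[OF group.group_center_normal[OF group_SL], of M N] assms
  by (simp add: PSL_def FactGroup_def center_coset)

lemma one_PSL: "\<one>\<^bsub>PSL\<^esub> = pm (mat 1 :: 'k::field ^ 2 ^ 2)"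
  by (simp add: PSL_def FactGroup_def group_center_SL pm_def)

lemma pm_in_PSL: "det M = 1 \<Longrightarrow> pm M \<in> carrier PSL"
  by (simp add: carrier_PSL)

lemma PSL_E:
  assumes "x \<in> carrier (PSL :: ('k::field ^ 2 ^ 2) set monoid)"
  obtains M where "det M = 1" "x = pm M"
  using assms by (auto simp: carrier_PSL)

lemma det_SL_pow [simp]: "det M = 1 \<Longrightarrow> det (M [^]\<^bsub>SL\<^esub> (n :: nat)) = (1 :: 'k::field)"
  by (induction n) (simp_all add: det_mul)

lemma pow_PSL:
  fixes M :: "'k::field ^ 2 ^ 2"
  assumes "det M = 1"
  shows "pm M [^]\<^bsub>PSL\<^esub> (n :: nat) = pm (M [^]\<^bsub>SL\<^esub> n)"
  by (induction n) (simp_all add: assms one_PSL mult_PSL)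

lemma eigenvector_SL_pow:
  fixes M :: "'k::field ^ 2 ^ 2"
  assumes "v v* M = c *s v"
  shows "v v* (M [^]\<^bsub>SL\<^esub> (n :: nat)) = c ^ n *s v"
  by (induction n)
    (simp_all add: assms vector_matrix_mul_assoc[symmetric] vector_smult_assoc mult.commute)

lemma inverse_in_SL:
  fixes M :: "'k::field ^ 2 ^ 2"
  assumes "det M = 1"
  obtains N where "det N = 1" "M ** N = mat 1" "N ** M = mat 1" "inv\<^bsub>PSL\<^esub> pm M = pm N"
proof -
  interpret S: group "SL :: ('k ^ 2 ^ 2) monoid" by (rule group_SL)
  interpret P: group "PSL :: ('k ^ 2 ^ 2) set monoid" by (rule group_PSL)
  let ?N = "inv\<^bsub>SL\<^esub> M"
  have N: "det ?N = 1" "M ** ?N = mat 1" "?N ** M = mat 1"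
    using S.inv_closed[of M] S.r_inv[of M] S.l_inv[of M] assms by simp_all
  moreover have "inv\<^bsub>PSL\<^esub> pm M = pm ?N"
    by (rule P.inv_equality) (simp_all add: mult_PSL one_PSL pm_in_PSL N assms)
  ultimately show ?thesis using that by blast
qed

section \<open>Elements of order p\<close>

text \<open>The orbits of a map of prime order without fixed points all have length \<open>p\<close>.\<close>

lemma prime_dvd_card_of_no_fixed_point:
  fixes f :: "'a \<Rightarrow> 'a"
  assumes p: "normalization_semidom_class.prime (p :: nat)" and fin: "finite M"
    and closed: "\<And>x. x \<in> M \<Longrightarrow> f x \<in> M"
    and period: "\<And>x. x \<in> M \<Longrightarrow> (f ^^ p) x = x"
    and no_fix: "\<And>x. x \<in> M \<Longrightarrow> f x \<noteq> x"
  shows "p dvd card M"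
proof -
  have iter_closed: "(f ^^ n) x \<in> M" if "x \<in> M" for n x
    by (induction n) (simp_all add: that closed)
  have iter_p: "(f ^^ (p * n)) x = x" if "x \<in> M" for n x
    by (induction n) (simp_all add: that period funpow_add)
  have p0: "p > 0" using p prime_gt_0_nat by blast
  have iter_mod: "(f ^^ n) x = (f ^^ (n mod p)) x" if "x \<in> M" for n x
  proof -
    have "(f ^^ n) x = (f ^^ (n mod p + p * (n div p))) x" by simp
    then show ?thesis using iter_p[OF that] unfolding funpow_add comp_def by simp
  qed
  have iter_mult: "(f ^^ (d * n)) x = x" if "(f ^^ d) x = x" for d n x
    by (induction n) (simp_all add: that funpow_add)
  have free: "(f ^^ d) x \<noteq> x" if x: "x \<in> M" and d: "0 < d" "d < p" for d x
  proof
    assume *: "(f ^^ d) x = x"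
    \<comment> \<open>A multiple of \<open>d\<close> is congruent to 1 modulo \<open>p\<close>, so a
      point fixed by the \<open>d\<close>-th iterate would be fixed by \<open>f\<close>
      itself.\<close>
    have "coprime d p"
      using p d by (metis coprime_commute nat_dvd_not_less prime_imp_coprime_nat)
    then obtain n where "[d * n = 1] (mod p)" using cong_solve_coprime_nat by fastforce
    then have "(d * n) mod p = 1"
      using prime_gt_1_nat[OF p] by (simp add: cong_def)
    then have "(f ^^ (d * n)) x = f x" using iter_mod[OF x, of "d * n"] by simp
    then show False using iter_mult[OF *, of n] no_fix[OF x] by simp
  qed
  define r where "r = {(x, (f ^^ n) x) | x n. x \<in> M}"
  have "equiv M r"
  proof (rule equivI)
    show "r \<subseteq> M \<times> M" using iter_closed by (auto simp: r_def)
    show "refl_on M r" by (rule refl_onI) (auto simp: r_def intro!: exI[of _ 0])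
    show "sym r"
    proof (rule symI)
      fix x y assume "(x, y) \<in> r"
      then obtain n where n: "x \<in> M" "y = (f ^^ n) x" by (auto simp: r_def)
      have "(f ^^ (p * n - n)) y = (f ^^ (p * n)) x"
        unfolding n(2) funpow_add[THEN fun_cong, unfolded comp_def, symmetric] using p0 by simp
      then have "x = (f ^^ (p * n - n)) y" using iter_p n(1) by simp
      then show "(y, x) \<in> r" using iter_closed n by (auto simp: r_def)
    qed
    show "trans r"
    proof (rule transI)
      fix x y z assume "(x, y) \<in> r" "(y, z) \<in> r"
      then obtain m n where "x \<in> M" "y = (f ^^ m) x" "z = (f ^^ n) y" by (auto simp: r_def)
      then have "x \<in> M" "z = (f ^^ (n + m)) x" by (simp_all add: funpow_add)
      then show "(x, z) \<in> r" unfolding r_def by blast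
    qed
  qed
  moreover have "p dvd card C" if C: "C \<in> M // r" for C
  proof -
    obtain x where x: "x \<in> M" "C = r `` {x}" using C by (rule quotientE)
    have "C = (\<lambda>n. (f ^^ n) x) ` {..<p}"
    proof (intro equalityI subsetI)
      fix y assume "y \<in> C"
      then obtain n where "y = (f ^^ n) x" using x by (auto simp: r_def)
      then have "y = (f ^^ (n mod p)) x" using iter_mod[OF x(1), of n] by (rule trans)
      then show "y \<in> (\<lambda>n. (f ^^ n) x) ` {..<p}" by (rule image_eqI) (use p0 in simp)
    qed (auto simp: x r_def)
    moreover have "inj_on (\<lambda>n. (f ^^ n) x) {..<p}"
    proof (rule linorder_inj_onI')
      fix i j assume ij: "i \<in> {..<p}" "j \<in> {..<p}" "i < j"
      show "(f ^^ i) x \<noteq> (f ^^ j) x"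
      proof
        assume "(f ^^ i) x = (f ^^ j) x"
        then have "(f ^^ (j - i)) ((f ^^ i) x) = (f ^^ i) x"
          unfolding funpow_add[THEN fun_cong, unfolded comp_def, symmetric] using ij by simp
        moreover have "0 < j - i" "j - i < p" using ij by auto
        ultimately show False using free[OF iter_closed[OF x(1)]] by blast
      qed
    qed
    ultimately show ?thesis by (simp add: card_image)
  qed
  ultimately show ?thesis using fin equiv_imp_dvd_card by blast
qed

text \<open>Otherwise \<open>A\<close> would permute the \<open>p^2 - 1\<close> nonzero vectors in
  orbits of length \<open>p\<close>, but \<open>p\<close> does not divide that number.\<close>

lemma ex_fixed_vector_of_order_p:
  fixes A :: "'k::field ^ 2 ^ 2"
  assumes p: "normalization_semidom_class.prime CARD('k)"
    and det: "det A = 1" and pow: "A [^]\<^bsub>SL\<^esub> CARD('k) = mat 1"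
  shows "\<exists>v. v \<noteq> 0 \<and> v v* A = v"
proof (rule ccontr)
  let ?M = "UNIV - {0 :: 'k ^ 2}" and ?f = "\<lambda>v. v v* A"
  assume "\<not> ?thesis"
  then have no_fix: "v v* A \<noteq> v" if "v \<noteq> 0" for v using that by blast
  have card: "CARD('k ^ 2) = CARD('k) ^ 2" by simp
  have "CARD('k) > 1" using prime_gt_1_nat[OF p] .
  then have fin: "finite (UNIV :: ('k ^ 2) set)"
    using card by (intro card_ge_0_finite) simp
  have iter: "(?f ^^ n) v = v v* (A [^]\<^bsub>SL\<^esub> n)" for n v
    by (induction n) (simp_all add: vector_matrix_mul_assoc)
  have "CARD('k) dvd card ?M"
    by (rule prime_dvd_card_of_no_fixed_point[OF p, of _ ?f])
      (use fin no_fix det in \<open>auto simp: vector_matrix_mult_eq_0_iff iter pow\<close>)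
  moreover have "card ?M + 1 = CARD('k) ^ 2"
    using fin \<open>CARD('k) > 1\<close> card by (simp add: card_Diff_singleton)
  ultimately have "CARD('k) dvd 1"
    by (metis dvd_add_right_iff dvd_power zero_less_numeral)
  then show False using \<open>CARD('k) > 1\<close> by simp
qed

text \<open>For the lift \<open>A = M ^ (p + 1)\<close> of \<open>pm M\<close> the sign of \<open>M ^ p\<close> disappears.\<close>

lemma PSL_order_p_lift:
  fixes a :: "('k::field ^ 2 ^ 2) set"
  assumes p: "normalization_semidom_class.prime CARD('k)" "odd CARD('k)"
    and a: "a \<in> carrier PSL" "a [^]\<^bsub>PSL\<^esub> CARD('k) = \<one>\<^bsub>PSL\<^esub>"
  obtains A where "det A = 1" "a = pm A" "A [^]\<^bsub>SL\<^esub> CARD('k) = mat 1"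
proof -
  interpret S: group "SL :: ('k ^ 2 ^ 2) monoid" by (rule group_SL)
  let ?p = "CARD('k)"
  obtain M where M: "det M = 1" "a = pm M" using a(1) by (rule PSL_E)
  then have Mp: "M [^]\<^bsub>SL\<^esub> ?p = mat 1 \<or> M [^]\<^bsub>SL\<^esub> ?p = - mat 1"
    using a(2) by (simp add: pow_PSL one_PSL pm_eq_iff)
  let ?A = "M [^]\<^bsub>SL\<^esub> Suc ?p"
  \<comment> \<open>As \<open>p + 1\<close> is even, the \<open>p\<close>-th power of
    \<open>?A\<close> is a power of the square of \<open>M ^ p\<close>. Since \<open>M ^ p\<close>
    is 1 or -1, that square is 1, and \<open>?A\<close> is \<open>M\<close> or its negative, still a
    lift of \<open>a\<close>.\<close>
  obtain k where k: "Suc ?p = 2 * k" using p(2) by (metis evenE even_Suc)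
  have "?A [^]\<^bsub>SL\<^esub> ?p = ((M [^]\<^bsub>SL\<^esub> ?p) [^]\<^bsub>SL\<^esub> (2::nat)) [^]\<^bsub>SL\<^esub> k"
    using M by (simp add: S.nat_pow_pow k mult_ac del: S.nat_pow_Suc)
  also have "(M [^]\<^bsub>SL\<^esub> ?p) [^]\<^bsub>SL\<^esub> (2::nat) = mat 1"
    using Mp by (auto simp: numeral_2_eq_2 uminus_matrix_mult)
  also have "mat 1 [^]\<^bsub>SL\<^esub> k = (mat 1 :: 'k ^ 2 ^ 2)"
    using S.nat_pow_one[of k] by simp
  finally have "?A [^]\<^bsub>SL\<^esub> ?p = mat 1" .
  moreover have "a = pm ?A"
    using Mp M by (auto simp: pm_eq_iff uminus_matrix_mult)
  moreover have "det ?A = 1" using M(1) by (rule det_SL_pow)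
  ultimately show ?thesis by (intro that)
qed

section \<open>Normalizers\<close>

context group
begin

lemma mem_normalizer_conj:
  assumes "K \<subseteq> carrier G" "x \<in> normalizer G K" "k \<in> K"
  shows "x \<otimes> k \<otimes> inv x \<in> K"
  using assms unfolding normalizer_def stabilizer_def r_coset_def l_coset_def by auto

lemma mem_normalizerI:
  assumes K: "K \<subseteq> carrier G" and x: "x \<in> carrier G"
    and conj: "\<And>k. k \<in> K \<Longrightarrow> x \<otimes> k \<otimes> inv x \<in> K" "\<And>k. k \<in> K \<Longrightarrow> inv x \<otimes> k \<otimes> x \<in> K"
  shows "x \<in> normalizer G K"
proof -
  have "x <# K #> inv x = K"
  proof (intro equalityI subsetI)
    fix k assume k: "k \<in> K"
    have kG: "k \<in> carrier G" using k K by blast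
    have "x \<otimes> (inv x \<otimes> k \<otimes> x) = k \<otimes> x"
      using kG x by (simp add: m_assoc[symmetric])
    then have "k = x \<otimes> (inv x \<otimes> k \<otimes> x) \<otimes> inv x"
      using kG x by (simp add: m_assoc)
    then show "k \<in> x <# K #> inv x"
      using conj(2)[OF k] unfolding r_coset_def l_coset_def by blast
  qed (use conj(1) in \<open>auto simp: r_coset_def l_coset_def\<close>)
  then show ?thesis using K x by (simp add: normalizer_def stabilizer_def)
qed

end

section \<open>The normalizer of a unipotent subgroup\<close>

text \<open>In the basis \<open>v0\<close>, \<open>v1\<close> the lift \<open>A\<close> is a
  nontrivial transvection. In \<open>ord_A\<close>, the value 0 would stand for infinite order;
  excluding it makes \<open>K\<close> the set of natural powers.\<close>

locale unipotent_generator =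
  fixes A :: "'k::field ^ 2 ^ 2" and v0 v1 :: "'k ^ 2" and t :: 'k
  assumes prime_card: "normalization_semidom_class.prime CARD('k)"
    and card_mod_4: "CARD('k) mod 4 = 1"
    and det_A: "det A = 1" and det_basis: "det2 v0 v1 = 1"
    and v0_A: "v0 v* A = v0" and v1_A: "v1 v* A = v1 + t *s v0" and t_nonzero: "t \<noteq> 0"
    and ord_A: "group.ord PSL (pm A) \<noteq> 0"
begin

sublocale group "PSL :: ('k ^ 2 ^ 2) set monoid"
  by (rule group_PSL)

abbreviation G :: "('k ^ 2 ^ 2) set monoid" where "G \<equiv> PSL"
abbreviation K :: "('k ^ 2 ^ 2) set set" where "K \<equiv> generate PSL {pm A}"

lemma two_neq_zero: "(2 :: 'k) \<noteq> 0"
proof (rule two_neq_zero_of_odd_prime_card[OF prime_card])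
  show "CARD('k) \<noteq> 2"
  proof
    assume "CARD('k) = 2"
    with card_mod_4 show False by simp
  qed
qed

lemma v0_nonzero: "v0 \<noteq> 0"
  using det_basis by auto

lemma det2_basis_nonzero: "det2 v0 v1 \<noteq> 0"
  using det_basis by simp

lemma subgroup_K: "subgroup K G"
  by (rule generate_is_subgroup) (simp add: pm_in_PSL det_A)

lemma K_closed: "K \<subseteq> carrier G"
  by (rule subgroup.subset[OF subgroup_K])

lemma v1_A_pow: "v1 v* (A [^]\<^bsub>SL\<^esub> (n :: nat)) = v1 + (of_nat n * t) *s v0"
proof (induction n)
  case (Suc n)
  have "v1 v* (A [^]\<^bsub>SL\<^esub> Suc n) = (v1 + (of_nat n * t) *s v0) v* A"
    by (simp add: vector_matrix_mul_assoc[symmetric] Suc)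
  also have "\<dots> = v1 + (of_nat (Suc n) * t) *s v0"
    by (simp add: vector_matrix_left_distrib v0_A v1_A vector_sadd_rdistrib distrib_right add_ac)
  finally show ?case .
qed simp

lemma v1_image_of_fixing_v0:
  assumes "det M = 1" "v0 v* M = v0"
  obtains c where "v1 v* M = v1 + c *s v0"
proof -
  obtain c d where cd: "v1 v* M = c *s v0 + d *s v1" using vec2_expand[OF det2_basis_nonzero] .
  have "det2 (v0 v* M) (v1 v* M) = 1" by (simp add: assms(1) det_basis)
  then have "d = 1" by (simp add: assms(2) cd det_basis)
  then show thesis using that[of c] cd by (simp add: add.commute)
qed

text \<open>Powers of \<open>A\<close> add to \<open>v1\<close> the natural multiples of
  \<open>t *s v0\<close>, and over a prime field these are all multiples of \<open>v0\<close>. So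
  every matrix of determinant 1 fixing \<open>v0\<close> is a power of \<open>A\<close>; the second
  alternative accounts for the other lift.\<close>

lemma pm_in_K_iff:
  assumes det: "det M = 1"
  shows "pm M \<in> K \<longleftrightarrow> v0 v* M = v0 \<or> v0 v* M = - v0"
proof -
  have A_pow: "v0 v* (A [^]\<^bsub>SL\<^esub> (n :: nat)) = v0" for n
    using eigenvector_SL_pow[of v0 A 1 n] v0_A by simp
  have K_eq: "K = {pm (A [^]\<^bsub>SL\<^esub> n) | n. n \<in> (UNIV :: nat set)}"
    using generate_pow_nat[OF pm_in_PSL[OF det_A] ord_A] by (simp add: pow_PSL det_A)
  have mem: "pm N \<in> K" if N: "det N = 1" "v0 v* N = v0" for N
  proof -
    obtain c where c: "v1 v* N = v1 + c *s v0" using v1_image_of_fixing_v0[OF N] .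
    obtain n where "of_nat n = c / t"
      using surj_of_nat_prime_card[OF prime_card] by (metis surjD)
    then have "N = A [^]\<^bsub>SL\<^esub> n"
      using c N(2) A_pow[of n] v1_A_pow[of n] t_nonzero
      by (intro matrix_eq_on_basis[OF det2_basis_nonzero]) simp_all
    then show ?thesis using K_eq by blast
  qed
  show ?thesis
  proof
    assume "pm M \<in> K"
    then obtain n :: nat where "pm M = pm (A [^]\<^bsub>SL\<^esub> n)" using K_eq by blast
    then show "v0 v* M = v0 \<or> v0 v* M = - v0"
      using A_pow[of n] by (auto simp: pm_eq_iff vector_matrix_mult_uminus)
  next
    assume "v0 v* M = v0 \<or> v0 v* M = - v0"
    then have "pm M \<in> K \<or> pm (- M) \<in> K"
      using mem[of M] mem[of "- M"] det by (auto simp: vector_matrix_mult_uminus)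
    moreover have "pm M = pm (- M)" by (simp add: pm_eq_iff)
    ultimately show "pm M \<in> K" by simp
  qed
qed

lemma K_E:
  assumes "x \<in> K"
  obtains M where "det M = 1" "x = pm M" "v0 v* M = v0"
proof -
  obtain M where M: "det M = 1" "x = pm M" using assms K_closed PSL_E by blast
  then have "v0 v* M = v0 \<or> v0 v* M = - v0" using pm_in_K_iff assms by simp
  then show thesis
    using that[of M] that[of "- M"] M by (auto simp: pm_eq_iff vector_matrix_mult_uminus)
qed

text \<open>Under conjugation the eigenvalues of \<open>M\<close> and its inverse on
  \<open>v0\<close> cancel, so a conjugate of a matrix fixing \<open>v0\<close> again fixes
  \<open>v0\<close>.\<close>

lemma eigenvector_imp_normalizes:
  assumes det: "det M = 1" and eig: "v0 v* M = c *s v0"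
  shows "pm M \<in> normalizer G K"
proof -
  obtain N where N: "det N = 1" "M ** N = mat 1" "N ** M = mat 1" "inv\<^bsub>G\<^esub> pm M = pm N"
    using inverse_in_SL[OF det] .
  have c: "c \<noteq> 0" using eig vector_matrix_mult_eq_0_iff[of M v0] v0_nonzero det by auto
  have "c *s (v0 v* N) = (v0 v* M) v* N" by (simp add: eig)
  also have "\<dots> = v0" by (simp add: vector_matrix_mul_assoc N)
  finally have "c *s (v0 v* N) = v0" .
  then have "inverse c *s (c *s (v0 v* N)) = inverse c *s v0" by simp
  then have eigN: "v0 v* N = inverse c *s v0" using c by (simp add: vector_smult_assoc)
  show ?thesis
  proof (rule mem_normalizerI[OF K_closed pm_in_PSL[OF det]])
    fix k assume "k \<in> K"
    then obtain C where C: "det C = 1" "k = pm C" "v0 v* C = v0" by (rule K_E)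
    have "v0 v* (M ** C ** N) = v0" "v0 v* (N ** C ** M) = v0"
      using c by (simp_all add: vector_matrix_mul_assoc[symmetric] eig eigN C vector_smult_assoc)
    then show "pm M \<otimes>\<^bsub>G\<^esub> k \<otimes>\<^bsub>G\<^esub> inv\<^bsub>G\<^esub> pm M \<in> K" "inv\<^bsub>G\<^esub> pm M \<otimes>\<^bsub>G\<^esub> k \<otimes>\<^bsub>G\<^esub> pm M \<in> K"
      using det N C by (simp_all add: mult_PSL det_mul pm_in_K_iff)
  qed
qed

text \<open>The conjugate of \<open>A\<close> by \<open>M\<close> lies in \<open>K\<close>, so
  \<open>A\<close> fixes \<open>v0 v* M\<close> up to sign, and only vectors on the line of
  \<open>v0\<close> have this property.\<close>

lemma normalizes_imp_eigenvector:
  assumes det: "det M = 1" and norm: "pm M \<in> normalizer G K"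
  obtains c where "v0 v* M = c *s v0" "c \<noteq> 0"
proof -
  obtain N where N: "det N = 1" "M ** N = mat 1" "N ** M = mat 1" "inv\<^bsub>G\<^esub> pm M = pm N"
    using inverse_in_SL[OF det] .
  have "pm A \<in> K" by (intro generate.incl) simp
  then have "pm (M ** A ** N) \<in> K"
    using mem_normalizer_conj[OF K_closed norm \<open>pm A \<in> K\<close>] det det_A N by (simp add: mult_PSL det_mul)
  then have "v0 v* (M ** A ** N) = v0 \<or> v0 v* (M ** A ** N) = - v0"
    using pm_in_K_iff det det_A N by (simp add: det_mul)
  moreover have eq: "(v0 v* M) v* A = (v0 v* (M ** A ** N)) v* M"
    by (simp add: vector_matrix_mul_assoc matrix_mul_assoc[symmetric] N)
  ultimately have or: "(v0 v* M) v* A = v0 v* M \<or> (v0 v* M) v* A = - (v0 v* M)"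
    unfolding eq by (elim disjE) (simp_all only: vector_matrix_mult_uminus simp_thms)
  obtain c d where cd: "v0 v* M = c *s v0 + d *s v1" using vec2_expand[OF det2_basis_nonzero] .
  have *: "(v0 v* M) v* A = v0 v* M + (d * t) *s v0"
    by (simp add: cd vector_matrix_left_distrib v0_A v1_A vector_add_ldistrib vector_smult_assoc)
  have "d = 0"
    using or
  proof
    assume "(v0 v* M) v* A = v0 v* M"
    then have "(d * t) *s v0 = 0" using * by simp
    then show "d = 0" using v0_nonzero t_nonzero by simp
  next
    \<comment> \<open>The \<open>v1\<close>-coordinate \<open>d\<close> is unchanged by
      \<open>A\<close>, so the sign gives \<open>d = - d\<close>.\<close>
    assume "(v0 v* M) v* A = - (v0 v* M)"
    then have "det2 v0 ((v0 v* M) v* A) = - det2 v0 (v0 v* M)" by simp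
    moreover have "det2 v0 (v0 v* M) = d" by (simp add: cd det_basis)
    ultimately have "d = - d" unfolding * by simp
    then have "2 * d = 0" by (metis add.right_inverse mult_2)
    then show "d = 0" using two_neq_zero by simp
  qed
  then have "v0 v* M = c *s v0" using cd by simp
  moreover from this have "c \<noteq> 0"
    using vector_matrix_mult_eq_0_iff[of M v0] v0_nonzero det by auto
  ultimately show thesis by (rule that)
qed

end

section \<open>The coset graph\<close>

lemma (in group) rcoset_eq_iff:
  assumes "subgroup H G" "x \<in> carrier G" "y \<in> carrier G"
  shows "H #> x = H #> y \<longleftrightarrow> y \<otimes> inv x \<in> H"
proof -
  interpret H: subgroup H G by fact
  have "H #> x = H #> y \<longleftrightarrow> y \<in> H #> x"
    using repr_independence[OF _ assms(2,1)] repr_independenceD[OF assms(1,3)] by blast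
  also have "\<dots> \<longleftrightarrow> y \<otimes> inv x \<in> H"
    using H.rcos_module[OF is_group assms(2,3)] .
  finally show ?thesis .
qed

lemma (in group) mult_inv_eq_imp:
  assumes "u \<otimes> inv v = w" "u \<in> carrier G" "v \<in> carrier G"
  shows "u = w \<otimes> v"
  using assms(2,3) unfolding assms(1)[symmetric] by (simp add: m_assoc)

text \<open>\<open>B\<close> and \<open>C0\<close> are lifts of \<open>b\<close> and
  \<open>g\<close>. The conditions \<open>B2_neq_one\<close> and \<open>C0_neq_one\<close> serve to
  show that \<open>g\<close> moves the line of \<open>v0\<close>.\<close>

locale psl_coset_graph = unipotent_generator A v0 v1 t
  for A :: "'k::field ^ 2 ^ 2" and v0 v1 t +
  fixes B C0 :: "'k ^ 2 ^ 2" and H :: "('k ^ 2 ^ 2) set set"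
  assumes det_B: "det B = 1" and det_C0: "det C0 = 1"
    and ord_B: "group.ord PSL (pm B) \<noteq> 0"
    and B2_neq_one: "pm B [^]\<^bsub>PSL\<^esub> (2 :: nat) \<noteq> \<one>\<^bsub>PSL\<^esub>"
    and C0_neq_one: "pm C0 \<noteq> \<one>\<^bsub>PSL\<^esub>"
    and normalizer_decomp:
      "semidirect_decomp PSL (normalizer PSL (generate PSL {pm A})) (generate PSL {pm A})
        (generate PSL {pm B})"
    and normalizer_B2_decomp:
      "semidirect_decomp PSL (normalizer PSL (generate PSL {pm B [^]\<^bsub>PSL\<^esub> (2 :: nat)}))
        (generate PSL {pm B}) (generate PSL {pm C0})"
    and H_decomp:
      "semidirect_decomp PSL H (generate PSL {pm A}) (generate PSL {pm B [^]\<^bsub>PSL\<^esub> (2 :: nat)})"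
begin

abbreviation b where "b \<equiv> pm B"
abbreviation g where "g \<equiv> pm C0"
abbreviation L where "L \<equiv> generate G {b}"
abbreviation L2 where "L2 \<equiv> generate G {b [^]\<^bsub>G\<^esub> (2 :: nat)}"

lemma b_closed: "b \<in> carrier G" by (rule pm_in_PSL[OF det_B])
lemma g_closed: "g \<in> carrier G" by (rule pm_in_PSL[OF det_C0])

lemma L_eq: "L = {b [^]\<^bsub>G\<^esub> n | n. n \<in> (UNIV :: nat set)}"
  using generate_pow_nat[OF b_closed ord_B] .

lemma L2_eq: "L2 = {b [^]\<^bsub>G\<^esub> (2 * n) | n. n \<in> (UNIV :: nat set)}"
proof -
  let ?b2 = "b [^]\<^bsub>G\<^esub> (2 :: nat)"
  have "?b2 [^]\<^bsub>G\<^esub> ord b = (b [^]\<^bsub>G\<^esub> ord b) [^]\<^bsub>G\<^esub> (2 :: nat)"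
    using b_closed by (simp add: nat_pow_pow mult.commute del: pow_ord_eq_1)
  then have "?b2 [^]\<^bsub>G\<^esub> ord b = \<one>\<^bsub>G\<^esub>" using b_closed by simp
  then have "ord ?b2 dvd ord b" using b_closed by (simp add: pow_eq_id)
  then have "ord ?b2 \<noteq> 0" using ord_B by auto
  then show ?thesis
    using generate_pow_nat[of ?b2] b_closed by (simp add: nat_pow_pow)
qed

lemma L2_subset_L: "L2 \<subseteq> L"
  unfolding L_eq L2_eq by blast

lemma subgroups: "subgroup L G" "subgroup L2 G" "subgroup H G" "subgroup (normalizer G L2) G"
  using H_decomp normalizer_B2_decomp
  by (auto simp: semidirect_decomp_def b_closed intro!: generate_is_subgroup)

lemma one_mem: "\<one>\<^bsub>G\<^esub> \<in> K" "\<one>\<^bsub>G\<^esub> \<in> L" "\<one>\<^bsub>G\<^esub> \<in> generate G {g}"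
  by (rule generate.one)+

lemma normalizer_K_eq: "normalizer G K = K <#>\<^bsub>G\<^esub> L"
  and K_Int_L: "K \<inter> L = {\<one>\<^bsub>G\<^esub>}"
  using normalizer_decomp by (simp_all add: semidirect_decomp_def)

lemma normalizer_L2_eq: "normalizer G L2 = L <#>\<^bsub>G\<^esub> generate G {g}"
  and L_Int_g: "L \<inter> generate G {g} = {\<one>\<^bsub>G\<^esub>}"
  using normalizer_B2_decomp by (simp_all add: semidirect_decomp_def)

lemma H_eq: "H = K <#>\<^bsub>G\<^esub> L2"
  using H_decomp by (simp add: semidirect_decomp_def)

lemma L_closed: "L \<subseteq> carrier G"
  by (rule subgroup.subset[OF subgroups(1)])

lemma L_normalizes_K: "L \<subseteq> normalizer G K"
proof
  fix x assume x: "x \<in> L"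
  then have "x = \<one>\<^bsub>G\<^esub> \<otimes>\<^bsub>G\<^esub> x" using L_closed by auto
  then show "x \<in> normalizer G K"
    unfolding normalizer_K_eq set_mult_def using x one_mem(1) by blast
qed

lemma L_normalizes_L2: "L \<subseteq> normalizer G L2"
proof
  fix x assume x: "x \<in> L"
  then have "x = x \<otimes>\<^bsub>G\<^esub> \<one>\<^bsub>G\<^esub>" using L_closed by auto
  then show "x \<in> normalizer G L2"
    unfolding normalizer_L2_eq set_mult_def using x one_mem(3) by blast
qed

lemma g_in_generate: "g \<in> generate G {g}" and b_in_L: "b \<in> L"
  by (simp_all add: generate.incl)

lemma g_normalizes_L2: "g \<in> normalizer G L2"
proof -
  have "g = \<one>\<^bsub>G\<^esub> \<otimes>\<^bsub>G\<^esub> g" using g_closed by simp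
  then show ?thesis
    unfolding normalizer_L2_eq set_mult_def using g_in_generate one_mem(2) by blast
qed

section \<open>The eigenvalue of \<open>b\<close> on \<open>v0\<close> and the description of
  \<open>H\<close>\<close>

definition l :: 'k where
  "l = (SOME c. v0 v* B = c *s v0 \<and> c \<noteq> 0)"

lemma v0_B: "v0 v* B = l *s v0" and l_nonzero: "l \<noteq> 0"
proof -
  obtain c where "v0 v* B = c *s v0 \<and> c \<noteq> 0"
    using normalizes_imp_eigenvector[OF det_B] L_normalizes_K b_in_L by blast
  then have "v0 v* B = l *s v0 \<and> l \<noteq> 0" unfolding l_def by (rule someI)
  then show "v0 v* B = l *s v0" "l \<noteq> 0" by auto
qed

lemma scale_v0_inject: "c *s v0 = d *s v0 \<longleftrightarrow> c = d" "c *s v0 = - (d *s v0) \<longleftrightarrow> c = - d"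
proof -
  show "c *s v0 = d *s v0 \<longleftrightarrow> c = d"
    using det_basis by (metis det2_bilinear(3) mult.right_neutral)
  then show "c *s v0 = - (d *s v0) \<longleftrightarrow> c = - d"
    using det_basis by (metis det2_bilinear(3,5) mult.right_neutral vector_sneg_minus1
        vector_smult_assoc mult_minus1)
qed

text \<open>The factor from \<open>K\<close> has a lift fixing \<open>v0\<close>, so only the power
  of \<open>b\<close> contributes; the sign comes from the choice of lift.\<close>

lemma eigenvalue_of_product:
  assumes "det M = 1" "v0 v* M = c *s v0" "x \<in> K" "pm M = x \<otimes>\<^bsub>G\<^esub> b [^]\<^bsub>G\<^esub> (n :: nat)"
  shows "c = l ^ n \<or> c = - (l ^ n)"
proof -
  obtain C where C: "det C = 1" "x = pm C" "v0 v* C = v0" using assms(3) by (rule K_E)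
  have "pm M = pm (C ** (B [^]\<^bsub>SL\<^esub> n))"
    using assms(4) C det_B by (simp add: pow_PSL mult_PSL)
  moreover have "v0 v* (C ** (B [^]\<^bsub>SL\<^esub> n)) = l ^ n *s v0"
    by (simp add: vector_matrix_mul_assoc[symmetric] C eigenvector_SL_pow[OF v0_B])
  ultimately have "c *s v0 = l ^ n *s v0 \<or> c *s v0 = - (l ^ n *s v0)"
    using assms(2) by (auto simp: pm_eq_iff vector_matrix_mult_uminus)
  then show ?thesis by (simp only: scale_v0_inject)
qed

lemma eigenvector_decomp:
  assumes "det M = 1" "v0 v* M = c *s v0"
  obtains x and n :: nat where "x \<in> K" "pm M = x \<otimes>\<^bsub>G\<^esub> b [^]\<^bsub>G\<^esub> n" "c = l ^ n \<or> c = - (l ^ n)"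
proof -
  have "pm M \<in> K <#>\<^bsub>G\<^esub> L"
    using eigenvector_imp_normalizes[OF assms] unfolding normalizer_K_eq .
  then obtain x and n :: nat where xn: "x \<in> K" "pm M = x \<otimes>\<^bsub>G\<^esub> b [^]\<^bsub>G\<^esub> n"
    unfolding set_mult_def L_eq by blast
  then show thesis using that[OF xn] eigenvalue_of_product[OF assms xn] by blast
qed

lemma minus_square_iff: "nz_square (- x) \<longleftrightarrow> nz_square (x :: 'k)"
  using nz_square_mult_iff[OF nz_square_minus_1[OF card_mod_4 two_neq_zero], of x] by simp

text \<open>For a nonsquare \<open>e\<close>, the matrix with eigenvalues \<open>e\<close> and
  \<open>inverse e\<close> normalizes \<open>K\<close>, so \<open>e\<close> is a power of
  \<open>l\<close> up to sign. Powers of a square and their negatives are squares.\<close>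

lemma l_nonsquare: "\<not> nz_square l"
proof
  assume l: "nz_square l"
  obtain e :: 'k where e: "e \<noteq> 0" "\<not> nz_square e"
    using ex_nonsquare[OF card_mod_4 two_neq_zero] by blast
  obtain M where M: "v0 v* M = e *s v0" "v1 v* M = inverse e *s v1"
    "det M * det2 v0 v1 = det2 (e *s v0) (inverse e *s v1)"
    using ex_matrix_det2[OF det2_basis_nonzero] .
  then have "det M = 1" using e by (simp add: det_basis)
  then obtain x and n :: nat where "e = l ^ n \<or> e = - (l ^ n)"
    using eigenvector_decomp[OF _ M(1)] by metis
  moreover have "nz_square (l ^ n)"
    by (induction n) (use nz_square_power2[of 1] nz_square_mult[OF l] in simp_all)
  ultimately show False using e(2) minus_square_iff by blast
qed

lemma nz_square_l_power: "nz_square (l ^ n) \<longleftrightarrow> even n"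
proof (cases "even n")
  case True
  then obtain m where "n = 2 * m" by (rule evenE)
  then have "l ^ n = (l ^ m) ^ 2" by (simp add: power_mult mult.commute)
  then show ?thesis using nz_square_power2[of "l ^ m"] l_nonzero True by simp
next
  case False
  then obtain m where "n = 2 * m + 1" by (rule oddE)
  then have "l ^ n = (l ^ m) ^ 2 * l" by (simp add: power_mult mult.commute)
  then show ?thesis
    using nz_square_power2_mult_iff[of "l ^ m" l] l_nonzero l_nonsquare False by simp
qed

text \<open>\<open>H\<close> consists of products of elements of \<open>K\<close> with even powers
  of \<open>b\<close>, and the even powers of \<open>l\<close> are exactly its square
  powers.\<close>

lemma pm_in_H_iff:
  assumes det: "det M = 1"
  shows "pm M \<in> H \<longleftrightarrow> (\<exists>c. nz_square c \<and> v0 v* M = c *s v0)"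
proof
  assume "pm M \<in> H"
  then obtain x and n :: nat where xn: "x \<in> K" "pm M = x \<otimes>\<^bsub>G\<^esub> b [^]\<^bsub>G\<^esub> (2 * n)"
    unfolding H_eq set_mult_def L2_eq by blast
  have "pm M \<in> normalizer G K"
    unfolding normalizer_K_eq set_mult_def L_eq using xn by blast
  then obtain c where c: "v0 v* M = c *s v0" using normalizes_imp_eigenvector[OF det] by metis
  then have "c = l ^ (2 * n) \<or> c = - (l ^ (2 * n))" using eigenvalue_of_product[OF det _ xn] by blast
  then have "nz_square c" using nz_square_l_power[of "2 * n"] minus_square_iff by auto
  then show "\<exists>c. nz_square c \<and> v0 v* M = c *s v0" using c by blast
next
  assume "\<exists>c. nz_square c \<and> v0 v* M = c *s v0"
  then obtain c where c: "nz_square c" "v0 v* M = c *s v0" by blast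
  obtain x and n :: nat where xn: "x \<in> K" "pm M = x \<otimes>\<^bsub>G\<^esub> b [^]\<^bsub>G\<^esub> n" "c = l ^ n \<or> c = - (l ^ n)"
    using eigenvector_decomp[OF det c(2)] .
  then have "nz_square (l ^ n)" using c(1) minus_square_iff by blast
  then obtain m where "n = 2 * m" using nz_square_l_power by (metis evenE)
  then have "b [^]\<^bsub>G\<^esub> n \<in> L2" unfolding L2_eq by blast
  then show "pm M \<in> H" unfolding H_eq set_mult_def using xn by blast
qed

text \<open>The lift of \<open>b ^ 2\<close> is triangular with diagonal entries
  \<open>l ^ 2\<close> and \<open>q\<close>, inverse to each other. Commuting with the transvection
  of parameter \<open>s\<close> forces \<open>s * (l ^ 2 - q) = 0\<close>; equal entries would be 1
  or -1, placing \<open>b ^ 2\<close> in \<open>K \<inter> L\<close>, which is trivial.\<close>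

lemma K_commuting_with_b2_trivial:
  assumes x: "x \<in> K"
    and comm: "x \<otimes>\<^bsub>G\<^esub> b [^]\<^bsub>G\<^esub> (2 :: nat) = b [^]\<^bsub>G\<^esub> (2 :: nat) \<otimes>\<^bsub>G\<^esub> x"
  shows "x = \<one>\<^bsub>G\<^esub>"
proof -
  obtain C where C: "det C = 1" "x = pm C" "v0 v* C = v0" using x by (rule K_E)
  obtain s where s: "v1 v* C = v1 + s *s v0" using v1_image_of_fixing_v0[OF C(1,3)] .
  define D where "D = B [^]\<^bsub>SL\<^esub> (2 :: nat)"
  have D: "det D = 1" "b [^]\<^bsub>G\<^esub> (2 :: nat) = pm D" "v0 v* D = l ^ 2 *s v0"
    using det_B eigenvector_SL_pow[OF v0_B, of 2] by (simp_all add: D_def pow_PSL)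
  obtain r q where rq: "v1 v* D = r *s v0 + q *s v1" using vec2_expand[OF det2_basis_nonzero] .
  have "det2 (v0 v* D) (v1 v* D) = 1" using D(1) det_basis by simp
  then have q: "l ^ 2 * q = 1" by (simp add: D(3) rq det_basis mult.commute)
  \<comment> \<open>Equality in PSL(2,p) permits a sign, which is excluded by evaluating at
    \<open>v0\<close>.\<close>
  have "C ** D = D ** C \<or> C ** D = - (D ** C)"
    using comm C D by (simp add: mult_PSL pm_eq_iff)
  moreover have "C ** D \<noteq> - (D ** C)"
  proof
    assume "C ** D = - (D ** C)"
    then have "v0 v* (C ** D) = - (v0 v* (D ** C))" by (simp add: vector_matrix_mult_uminus)
    then have "l ^ 2 *s v0 = - (l ^ 2 *s v0)"
      by (simp add: vector_matrix_mul_assoc[symmetric] C D)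
    then have "l ^ 2 = - (l ^ 2)" by (simp only: scale_v0_inject)
    then have "2 * l ^ 2 = 0" by (metis add.right_inverse mult_2)
    then show False using two_neq_zero l_nonzero by simp
  qed
  ultimately have "v1 v* (C ** D) = v1 v* (D ** C)" by simp
  then have "(r + s * l ^ 2) *s v0 + q *s v1 = (r + q * s) *s v0 + q *s v1"
    by (simp add: vector_matrix_mul_assoc[symmetric] s rq C D vector_matrix_left_distrib
        vector_sadd_rdistrib vector_add_ldistrib vector_smult_assoc add_ac)
  then have "s * l ^ 2 = q * s" by (simp only: add_right_cancel add_left_cancel scale_v0_inject)
  then have "s * (l ^ 2 - q) = 0" by (simp add: algebra_simps)
  moreover have "l ^ 2 \<noteq> q"
  proof
    assume "l ^ 2 = q"
    then have "l ^ 2 = 1 \<or> l ^ 2 = - 1" using q by (simp add: square_eq_1_iff)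
    then have "v0 v* D = v0 \<or> v0 v* D = - v0"
      using D(3) by (auto simp: vector_sneg_minus1[symmetric])
    then have "b [^]\<^bsub>G\<^esub> (2 :: nat) \<in> K \<inter> L"
      unfolding D(2)[symmetric] using pm_in_K_iff[OF D(1)] D(2) L_eq by auto
    then show False using K_Int_L B2_neq_one by blast
  qed
  ultimately have "s = 0" by simp
  then have "C = mat 1"
    using s C(3) by (intro matrix_eq_on_basis[OF det2_basis_nonzero]) simp_all
  then show ?thesis by (simp add: C(2) one_PSL)
qed

section \<open>The line of \<open>v0\<close> is not fixed by \<open>g\<close>\<close>

definition kappa :: 'k where
  "kappa = det2 v0 (v0 v* C0)"

text \<open>If \<open>g\<close> fixed the line of \<open>v0\<close>, it would be \<open>x * b ^ n\<close> with \<open>x\<close> in \<open>K\<close> normalizing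
  \<open>L2\<close>; then the commutator of \<open>x\<close> and \<open>b ^ 2\<close> lies in \<open>K \<inter> L\<close>, so it is trivial.\<close>

lemma kappa_nonzero: "kappa \<noteq> 0"
proof
  assume "kappa = 0"
  then obtain c where "v0 v* C0 = c *s v0"
    unfolding kappa_def using det2_eq_zero_imp[OF v0_nonzero] by metis
  then obtain x and n :: nat where x: "x \<in> K" and g: "g = x \<otimes>\<^bsub>G\<^esub> b [^]\<^bsub>G\<^esub> n"
    using eigenvector_decomp[OF det_C0] by metis
  let ?b2 = "b [^]\<^bsub>G\<^esub> (2 :: nat)"
  have xG: "x \<in> carrier G" using x K_closed by blast
  have b2: "?b2 \<in> carrier G" "?b2 \<in> L2" "?b2 \<in> L"
    using b_closed L2_subset_L by (auto intro: generate.incl)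
  have bn: "b [^]\<^bsub>G\<^esub> n \<in> L" unfolding L_eq by blast
  have "inv\<^bsub>G\<^esub> (b [^]\<^bsub>G\<^esub> n) \<in> normalizer G L2"
    using subgroup.m_inv_closed[OF subgroups(4)] bn L_normalizes_L2 by blast
  then have "g \<otimes>\<^bsub>G\<^esub> inv\<^bsub>G\<^esub> (b [^]\<^bsub>G\<^esub> n) \<in> normalizer G L2"
    by (rule subgroup.m_closed[OF subgroups(4) g_normalizes_L2])
  moreover have "g \<otimes>\<^bsub>G\<^esub> inv\<^bsub>G\<^esub> (b [^]\<^bsub>G\<^esub> n) = x"
    unfolding g using xG b_closed by (simp add: m_assoc)
  ultimately have "x \<in> normalizer G L2" by simp
  then have "x \<otimes>\<^bsub>G\<^esub> ?b2 \<otimes>\<^bsub>G\<^esub> inv\<^bsub>G\<^esub> x \<in> L2"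
    using mem_normalizer_conj[OF subgroup.subset[OF subgroups(2)]] b2 by blast
  \<comment> \<open>The commutator is bracketed in two ways: as a conjugate of \<open>?b2\<close> by
    \<open>x\<close> times an element of \<open>L2\<close>, and as \<open>x\<close> times a
    conjugate of its inverse by \<open>?b2\<close>.\<close>
  then have "x \<otimes>\<^bsub>G\<^esub> ?b2 \<otimes>\<^bsub>G\<^esub> inv\<^bsub>G\<^esub> x \<otimes>\<^bsub>G\<^esub> inv\<^bsub>G\<^esub> ?b2 \<in> L"
    using subgroup.m_closed[OF subgroups(2)] subgroup.m_inv_closed[OF subgroups(2)] b2 L2_subset_L
    by blast
  moreover have "x \<otimes>\<^bsub>G\<^esub> ?b2 \<otimes>\<^bsub>G\<^esub> inv\<^bsub>G\<^esub> x \<otimes>\<^bsub>G\<^esub> inv\<^bsub>G\<^esub> ?b2 \<in> K"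
  proof -
    have "?b2 \<otimes>\<^bsub>G\<^esub> inv\<^bsub>G\<^esub> x \<otimes>\<^bsub>G\<^esub> inv\<^bsub>G\<^esub> ?b2 \<in> K"
      using L_normalizes_K b2(3) subgroup.m_inv_closed[OF subgroup_K x]
      by (intro mem_normalizer_conj[OF K_closed]) auto
    then have "x \<otimes>\<^bsub>G\<^esub> (?b2 \<otimes>\<^bsub>G\<^esub> inv\<^bsub>G\<^esub> x \<otimes>\<^bsub>G\<^esub> inv\<^bsub>G\<^esub> ?b2) \<in> K"
      using subgroup.m_closed[OF subgroup_K x] by blast
    then show ?thesis using xG b2(1) by (simp add: m_assoc)
  qed
  ultimately have "x \<otimes>\<^bsub>G\<^esub> ?b2 \<otimes>\<^bsub>G\<^esub> inv\<^bsub>G\<^esub> x \<otimes>\<^bsub>G\<^esub> inv\<^bsub>G\<^esub> ?b2 = \<one>\<^bsub>G\<^esub>"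
    using K_Int_L by blast
  then have "x \<otimes>\<^bsub>G\<^esub> ?b2 \<otimes>\<^bsub>G\<^esub> inv\<^bsub>G\<^esub> x = \<one>\<^bsub>G\<^esub> \<otimes>\<^bsub>G\<^esub> ?b2"
    using xG b2(1) by (intro mult_inv_eq_imp) simp_all
  then have "x \<otimes>\<^bsub>G\<^esub> ?b2 \<otimes>\<^bsub>G\<^esub> inv\<^bsub>G\<^esub> x = ?b2" using b2(1) by simp
  then have "x \<otimes>\<^bsub>G\<^esub> ?b2 = ?b2 \<otimes>\<^bsub>G\<^esub> x"
    using xG b2(1) by (intro mult_inv_eq_imp) simp_all
  then have "x = \<one>\<^bsub>G\<^esub>" by (rule K_commuting_with_b2_trivial[OF x])
  \<comment> \<open>With \<open>x\<close> trivial, \<open>g\<close> is a power of \<open>b\<close>,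
    although the cyclic groups of \<open>b\<close> and \<open>g\<close> meet trivially.\<close>
  then have "g \<in> L" using g bn b_closed by simp
  then show False using L_Int_g g_in_generate C0_neq_one by blast
qed

section \<open>Cosets of \<open>H\<close> as vectors modulo squares\<close>

definition phi :: "'k ^ 2 \<Rightarrow> ('k ^ 2 ^ 2) set set" where
  "phi v = H #>\<^bsub>G\<^esub> pm (SOME M. det M = 1 \<and> v0 v* M = v)"

lemma ex_SL_maps_v0:
  assumes "v \<noteq> 0"
  obtains M where "det M = 1" "v0 v* M = v"
proof -
  obtain w where w: "det2 v w = 1" using ex_det2_eq[OF assms] .
  obtain M where "v0 v* M = v" "v1 v* M = w" "det M * det2 v0 v1 = det2 v w"
    using ex_matrix_det2[OF det2_basis_nonzero] .
  then show thesis using that[of M] w by (simp add: det_basis)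
qed

lemma v0_SL_nonzero: "det M = 1 \<Longrightarrow> v0 v* M \<noteq> 0"
  using vector_matrix_mult_eq_0_iff[of M v0] v0_nonzero by simp

lemma H_coset_eq_iff:
  assumes det: "det M = 1" "det N = 1"
  shows "H #>\<^bsub>G\<^esub> pm M = H #>\<^bsub>G\<^esub> pm N \<longleftrightarrow> (\<exists>c. nz_square c \<and> v0 v* N = c *s (v0 v* M))"
proof -
  obtain M' where M': "det M' = 1" "M ** M' = mat 1" "M' ** M = mat 1" "inv\<^bsub>G\<^esub> pm M = pm M'"
    using inverse_in_SL[OF det(1)] .
  have *: "v0 v* (N ** M') = c *s v0 \<longleftrightarrow> v0 v* N = c *s (v0 v* M)" for c
  proof
    assume "v0 v* (N ** M') = c *s v0"
    then have "(v0 v* (N ** M')) v* M = (c *s v0) v* M" by simp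
    then show "v0 v* N = c *s (v0 v* M)"
      by (simp add: vector_matrix_mul_assoc matrix_mul_assoc[symmetric] M')
  next
    assume "v0 v* N = c *s (v0 v* M)"
    then have "(v0 v* N) v* M' = (c *s (v0 v* M)) v* M'" by simp
    then show "v0 v* (N ** M') = c *s v0" by (simp add: vector_matrix_mul_assoc M')
  qed
  have "H #>\<^bsub>G\<^esub> pm M = H #>\<^bsub>G\<^esub> pm N \<longleftrightarrow> pm (N ** M') \<in> H"
    using rcoset_eq_iff[OF subgroups(3) pm_in_PSL[OF det(1)] pm_in_PSL[OF det(2)]] M' det
    by (simp add: mult_PSL)
  also have "\<dots> \<longleftrightarrow> (\<exists>c. nz_square c \<and> v0 v* (N ** M') = c *s v0)"
    using pm_in_H_iff[of "N ** M'"] det M' by (simp add: det_mul)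
  finally show ?thesis by (simp only: *)
qed

text \<open>All matrices of determinant 1 carrying \<open>v0\<close> to the same vector lie over the
  same coset (the case \<open>c = 1\<close>), so the choice in \<open>phi\<close> is
  harmless.\<close>

lemma phi_v0_SL:
  assumes "det M = 1"
  shows "phi (v0 v* M) = H #>\<^bsub>G\<^esub> pm M"
proof -
  define M' where "M' = (SOME N. det N = 1 \<and> v0 v* N = v0 v* M)"
  have "det M' = 1 \<and> v0 v* M' = v0 v* M"
    unfolding M'_def by (rule someI[of _ M]) (simp add: assms)
  then have "H #>\<^bsub>G\<^esub> pm M' = H #>\<^bsub>G\<^esub> pm M"
    using H_coset_eq_iff[of M' M] assms nz_square_power2[of 1] by (auto intro!: exI[of _ 1])
  then show ?thesis by (simp add: phi_def M'_def)
qed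

sublocale square_class_graph "coset_graph G H (double_coset G H g)" phi kappa
proof unfold_locales
  let ?\<Gamma> = "coset_graph G H (double_coset G H g)"
  show "pverts ?\<Gamma> = phi ` {v. v \<noteq> 0}"
  proof (intro equalityI subsetI)
    fix y assume "y \<in> pverts ?\<Gamma>"
    then obtain M where "det M = 1" "y = H #>\<^bsub>G\<^esub> pm M"
      by (auto simp: coset_graph_def RCOSETS_def carrier_PSL)
    then show "y \<in> phi ` {v. v \<noteq> 0}" using phi_v0_SL v0_SL_nonzero by auto
  next
    fix y assume "y \<in> phi ` {v. v \<noteq> 0}"
    then obtain v where v: "v \<noteq> 0" "y = phi v" by blast
    obtain M where "det M = 1" "v0 v* M = v" using ex_SL_maps_v0[OF v(1)] .
    then show "y \<in> pverts ?\<Gamma>"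
      using v(2) phi_v0_SL[of M] by (auto simp: coset_graph_def RCOSETS_def carrier_PSL)
  qed
  show "phi u = phi v \<longleftrightarrow> (\<exists>c. nz_square c \<and> v = c *s u)" if uv: "u \<noteq> 0" "v \<noteq> 0" for u v
  proof -
    obtain M where M: "det M = 1" "v0 v* M = u" using ex_SL_maps_v0[OF uv(1)] .
    obtain N where N: "det N = 1" "v0 v* N = v" using ex_SL_maps_v0[OF uv(2)] .
    show ?thesis using H_coset_eq_iff[OF M(1) N(1)] phi_v0_SL[OF M(1)] phi_v0_SL[OF N(1)] M N by simp
  qed
  show "parcs ?\<Gamma> = {(phi u, phi v) | u v. det2 u v = kappa}"
  proof (intro equalityI subsetI)
    fix e assume "e \<in> parcs ?\<Gamma>"
    then obtain x y where e: "e = (H #>\<^bsub>G\<^esub> x, H #>\<^bsub>G\<^esub> y)" and xy: "x \<in> carrier G" "y \<in> carrier G"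
      and D: "y \<otimes>\<^bsub>G\<^esub> inv\<^bsub>G\<^esub> x \<in> double_coset G H g"
      by (auto simp: coset_graph_def)
    obtain h h' where h: "h \<in> H" "h' \<in> H" "y \<otimes>\<^bsub>G\<^esub> inv\<^bsub>G\<^esub> x = h \<otimes>\<^bsub>G\<^esub> g \<otimes>\<^bsub>G\<^esub> h'"
      using D by (auto simp: double_coset_def set_mult_def r_coset_def)
    have hG: "h \<in> carrier G" "h' \<in> carrier G" using h subgroup.subset[OF subgroups(3)] by auto
    have "y = h \<otimes>\<^bsub>G\<^esub> g \<otimes>\<^bsub>G\<^esub> h' \<otimes>\<^bsub>G\<^esub> x"
      by (rule mult_inv_eq_imp[OF h(3) xy(2,1)])
    then have y: "y = h \<otimes>\<^bsub>G\<^esub> (g \<otimes>\<^bsub>G\<^esub> (h' \<otimes>\<^bsub>G\<^esub> x))"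
      using xy hG g_closed by (simp add: m_assoc)
    obtain M where M: "det M = 1" "h' \<otimes>\<^bsub>G\<^esub> x = pm M"
      using PSL_E[OF m_closed[OF hG(2) xy(1)]] .
    have gM: "g \<otimes>\<^bsub>G\<^esub> (h' \<otimes>\<^bsub>G\<^esub> x) = pm (C0 ** M)" "det (C0 ** M) = 1"
      using M det_C0 by (simp_all add: mult_PSL det_mul)
    \<comment> \<open>Replacing \<open>x\<close> by \<open>h' x\<close> and \<open>y\<close> by
      \<open>g h' x\<close> keeps both cosets, and the new pair is represented by \<open>M\<close>
      and \<open>C0\<close> times \<open>M\<close>.\<close>
    have "H #>\<^bsub>G\<^esub> x = H #>\<^bsub>G\<^esub> (h' \<otimes>\<^bsub>G\<^esub> x)"
      using h(2) hG xy by (subst rcoset_eq_iff[OF subgroups(3)]) (simp_all add: m_assoc)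
    moreover have "H #>\<^bsub>G\<^esub> (g \<otimes>\<^bsub>G\<^esub> (h' \<otimes>\<^bsub>G\<^esub> x)) = H #>\<^bsub>G\<^esub> y"
    proof (subst rcoset_eq_iff[OF subgroups(3)])
      let ?z = "g \<otimes>\<^bsub>G\<^esub> (h' \<otimes>\<^bsub>G\<^esub> x)"
      show z: "?z \<in> carrier G" using hG xy g_closed by simp
      show "y \<in> carrier G" by fact
      show "y \<otimes>\<^bsub>G\<^esub> inv\<^bsub>G\<^esub> ?z \<in> H"
        unfolding y using z hG h(1) by (simp only: m_assoc inv_closed r_inv r_one)
    qed
    ultimately have "e = (phi (v0 v* M), phi (v0 v* (C0 ** M)))"
      using e M gM phi_v0_SL by simp
    moreover have "det2 (v0 v* M) (v0 v* (C0 ** M)) = kappa"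
      using M(1) by (simp add: kappa_def vector_matrix_mul_assoc[symmetric])
    ultimately show "e \<in> {(phi u, phi v) | u v. det2 u v = kappa}" by blast
  next
    fix e assume "e \<in> {(phi u, phi v) | u v. det2 u v = kappa}"
    then obtain u v where e: "e = (phi u, phi v)" and uv: "det2 u v = kappa" by blast
    \<comment> \<open>The basis \<open>v0\<close>, \<open>v0 v* C0\<close> and the pair
      \<open>u\<close>, \<open>v\<close> have the same determinant \<open>kappa\<close>, so the
      connecting matrix has determinant 1 and yields an element of PSL(2,p).\<close>
    obtain M where M: "v0 v* M = u" "(v0 v* C0) v* M = v"
      "det M * det2 v0 (v0 v* C0) = det2 u v"
      using ex_matrix_det2[of v0 "v0 v* C0" u v] kappa_nonzero unfolding kappa_def by blast
    then have det: "det M = 1" using uv kappa_nonzero by (simp add: kappa_def)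
    let ?x = "pm M"
    have x: "?x \<in> carrier G" by (rule pm_in_PSL[OF det])
    have "phi v = H #>\<^bsub>G\<^esub> (g \<otimes>\<^bsub>G\<^esub> ?x)"
      using phi_v0_SL[of "C0 ** M"] M(2) det det_C0
      by (simp add: det_mul mult_PSL vector_matrix_mul_assoc)
    moreover have "phi u = H #>\<^bsub>G\<^esub> ?x" using phi_v0_SL[OF det] M(1) by simp
    moreover have "g \<otimes>\<^bsub>G\<^esub> ?x \<otimes>\<^bsub>G\<^esub> inv\<^bsub>G\<^esub> ?x = \<one>\<^bsub>G\<^esub> \<otimes>\<^bsub>G\<^esub> g \<otimes>\<^bsub>G\<^esub> \<one>\<^bsub>G\<^esub>"
      using x g_closed by (simp add: m_assoc)
    then have "g \<otimes>\<^bsub>G\<^esub> ?x \<otimes>\<^bsub>G\<^esub> inv\<^bsub>G\<^esub> ?x \<in> double_coset G H g"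
      using subgroup.one_closed[OF subgroups(3)]
      unfolding double_coset_def set_mult_def r_coset_def by blast
    ultimately show "e \<in> parcs ?\<Gamma>"
      using e x g_closed by (auto simp: coset_graph_def)
  qed
  show "kappa \<noteq> 0" by (rule kappa_nonzero)
  show "nz_square (- 1 :: 'k)" by (rule nz_square_minus_1[OF card_mod_4 two_neq_zero])
  show "\<exists>e :: 'k. e \<noteq> 0 \<and> \<not> nz_square e" by (rule ex_nonsquare[OF card_mod_4 two_neq_zero])
  show "nz_square (x * y)" if "x \<noteq> 0" "y \<noteq> 0" "\<not> nz_square x" "\<not> nz_square y" for x y :: 'k
    using nz_square_mult_nonsquares[OF card_mod_4 two_neq_zero that] .
qed

end

theorem lemma5p8:
  fixes p :: nat
    and G :: "('k::field ^ 2 ^ 2) set monoid"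
    and a b g :: "('k ^ 2 ^ 2) set"
    and H :: "('k ^ 2 ^ 2) set set"
  assumes "normalization_semidom_class.prime p" and "p > 5" and "p mod 4 = 1"
    and "CARD('k) = p" and "G = PSL"
    and "a \<in> carrier G" and "group.ord G a = p"
    and "b \<in> carrier G" and "group.ord G b = (p - 1) div 2"
    and "semidirect_decomp G (normalizer G (generate G {a})) (generate G {a}) (generate G {b})"
    and "split_extension (G\<lparr>carrier := normalizer G (generate G {a})\<rparr>)
           (integer_mod_group p) (integer_mod_group ((p - 1) div 2))"
    and "g \<in> carrier G" and "group.ord G g = 2"
    and "semidirect_decomp G (normalizer G (generate G {b [^]\<^bsub>G\<^esub> (2::nat)}))
           (generate G {b}) (generate G {g})"
    and "G\<lparr>carrier := normalizer G (generate G {b [^]\<^bsub>G\<^esub> (2::nat)})\<rparr>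
           \<cong> dihedral_group ((p - 1) div 2)"
    and "semidirect_decomp G H (generate G {a}) (generate G {b [^]\<^bsub>G\<^esub> (2::nat)})"
  shows "two_geodesic_transitive (coset_graph G H (double_coset G H g)) \<and>
         \<not> two_arc_transitive (coset_graph G H (double_coset G H g))"
proof -
  note G = \<open>G = PSL\<close>
  interpret P: group "PSL :: ('k ^ 2 ^ 2) set monoid" by (rule group_PSL)
  have prime: "normalization_semidom_class.prime CARD('k)" using assms(1,4) by simp
  have mod4: "CARD('k) mod 4 = 1" using assms(3,4) by simp
  then have odd: "odd CARD('k)" by presburger
  have a: "a \<in> carrier PSL" "P.ord a = CARD('k)" using assms(4,6,7) G by auto
  then have "a [^]\<^bsub>PSL\<^esub> CARD('k) = \<one>\<^bsub>PSL\<^esub>" by (metis P.pow_ord_eq_1)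
  then obtain A where A: "det A = 1" "a = pm A" "A [^]\<^bsub>SL\<^esub> CARD('k) = mat 1"
    using PSL_order_p_lift[OF prime odd a(1)] by blast
  obtain v0 where v0: "v0 \<noteq> 0" "v0 v* A = v0"
    using ex_fixed_vector_of_order_p[OF prime A(1,3)] by blast
  obtain v1 where v1: "det2 v0 v1 = 1" using ex_det2_eq[OF v0(1)] .
  obtain t d where td: "v1 v* A = t *s v0 + d *s v1" using vec2_expand[of v0 v1] v1 by auto
  have "det2 (v0 v* A) (v1 v* A) = 1" using A(1) v1 by simp
  then have "d = 1" using v0 v1 td by simp
  then have v1_A: "v1 v* A = v1 + t *s v0" using td by (simp add: add.commute)
  have "t \<noteq> 0"
  proof
    assume "t = 0"
    then have "A = mat 1"
      using v0 v1 v1_A by (intro matrix_eq_on_basis[of v0 v1]) simp_all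
    then have "P.ord a = 1" by (simp add: A(2) flip: one_PSL)
    then show False using a(2) assms(2,4) by simp
  qed
  obtain B where B: "det B = 1" "b = pm B" using assms(8) G PSL_E by blast
  obtain C where C: "det C = 1" "g = pm C" using assms(12) G PSL_E by blast
  have "psl_coset_graph A v0 v1 t B C H"
  proof unfold_locales
    show "P.ord (pm A) \<noteq> 0" using a A assms(2,4) by simp
    show "P.ord (pm B) \<noteq> 0" using assms(2,9) B G by simp
    show "pm B [^]\<^bsub>PSL\<^esub> (2 :: nat) \<noteq> \<one>\<^bsub>PSL\<^esub>"
    proof
      assume "pm B [^]\<^bsub>PSL\<^esub> (2 :: nat) = \<one>\<^bsub>PSL\<^esub>"
      then have "P.ord b dvd 2" using B by (simp add: P.pow_eq_id pm_in_PSL)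
      \<comment> \<open>The order of \<open>b\<close> would be at most 2, which happens for p = 5
        but not for larger p.\<close>
      then have "(p - 1) div 2 \<le> 2" using assms(9) G by (simp add: dvd_imp_le)
      then show False using assms(2,3) by presburger
    qed
    show "pm C \<noteq> \<one>\<^bsub>PSL\<^esub>" using assms(13) C G by auto
  qed (use assms A B C G prime mod4 v0 v1 v1_A \<open>t \<noteq> 0\<close> in simp_all)
  then interpret psl_coset_graph A v0 v1 t B C H .
  show ?thesis
    using two_geodesic_transitive_not_two_arc_transitive unfolding G C(2) .
qed

end
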